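(* If a tree sequent $\Gamma\stackrel{\mathcal{T}}{\Rightarrow}\Delta$ is provable in $\mathsf{T}\mathbf{EFL}$, then its formulaic translation $[\![\Gamma\stackrel{\mathcal{T}}{\Rightarrow}\Delta]\!]_{i}$ at the root $i$ of $\mathcal{T}$ is provable in $\mathsf{H}\mathbf{EFL}$.
   Context: Syntax. Disjoint countably infinite sets $\mathsf{Prop}$ and $\mathsf{Nom}$ (agent nominals). Formulas: $\varphi ::= n \mid p \mid \bot \mid \varphi\to\varphi \mid @_{n}\varphi \mid \mathsf{F}\varphi \mid \Box\varphi$; $\neg,\top,\land,\lor,\leftrightarrow$ usual abbreviations; $\langle\mathsf{F}\rangle\varphi:=\neg\mathsf{F}\neg\varphi$. $@$-prefixed formulas have the form $@_n\varphi$. $\varphi[m/k]$ replaces nominal $k$ by $m$ everywhere. Uniform substitutions map propositional variables to formulas and nominals to nominals. Tree sequents. Labels: natural numbers, and $\alpha\cdot_ni$ (an $n$-child of $\alpha$) for label $\alpha$, nominal $n$, $i\in\mathbb{N}$. A tree: set of labels containing exactly one natural number (root), closed under parents. Labelled formula: $\alpha:\psi$, $\psi$ $@$-prefixed. Tree sequent $\Gamma\stackrel{\mathcal{T}}{\Rightarrow}\Delta$: finite sets of labelled formulas, finite tree containing their labels. Calculus $\mathsf{T}\mathbf{EFL}$ ($\alpha,\beta\in\mathcal{T}$; tree unchanged unless indicated). Initial: $\alpha:@_n\bot,\Gamma\Rightarrow\Delta$; $\alpha:@_n\varphi,\Gamma\Rightarrow\Delta,\alpha:@_n\varphi$. Rules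 (premises / conclusion): $(\mathsf{rep}_{=1})$ $\alpha:@_nm,\alpha:\varphi[n/k],\Gamma\Rightarrow\Delta$ / $\alpha:@_nm,\alpha:\varphi[m/k],\Gamma\Rightarrow\Delta$; $(\mathsf{rep}_{=2})$ $\alpha:@_nm,\alpha:\varphi[m/k],\Gamma\Rightarrow\Delta$ / $\alpha:@_nm,\alpha:\varphi[n/k],\Gamma\Rightarrow\Delta$; $(\mathsf{ref}_=)$ $\alpha:@_nn,\Gamma\Rightarrow\Delta$ / $\Gamma\Rightarrow\Delta$; $(\mathsf{rigid}_=)$ $\beta:@_nm,\Gamma\Rightarrow\Delta$ / $\alpha:@_nm,\Gamma\Rightarrow\Delta$; $(\to R)$ $\alpha:@_n\varphi,\Gamma\Rightarrow\Delta,\alpha:@_n\psi$ / $\Gamma\Rightarrow\Delta,\alpha:@_n(\varphi\to\psi)$; $(\to L)$ $\Gamma\Rightarrow\Delta,\alpha:@_n\varphi$ and $\alpha:@_n\psi,\Gamma\Rightarrow\Delta$ / $\alpha:@_n(\varphi\to\psi),\Gamma\Rightarrow\Delta$; $(@R)$ $\Gamma\Rightarrow\Delta,\alpha:@_m\varphi$ / $\Gamma\Rightarrow\Delta,\alpha:@_n@_m\varphi$; $(@L)$ $\alpha:@_m\varphi,\Gamma\Rightarrow\Delta$ / $\alpha:@_n@_m\varphi,\Gamma\Rightarrow\Delta$; $(\mathsf{F}R)$ $\alpha:@_n\langle\mathsf{F}\rangle m,\Gamma\Rightarrow\Delta,\alpha:@_m\varphi$ / $\Gamma\Rightarrow\Delta,\alpha:@_n\mathsf{F}\varphi$,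 $m$ not in the conclusion; $(\mathsf{F}L)$ $\Gamma\Rightarrow\Delta,\alpha:@_n\langle\mathsf{F}\rangle m$ and $\alpha:@_m\varphi,\Gamma\Rightarrow\Delta$ / $\alpha:@_n\mathsf{F}\varphi,\Gamma\Rightarrow\Delta$; $(\Box R)$ $\Gamma\stackrel{\mathcal{T}\cup\{\alpha\cdot_ni\}}{\Rightarrow}\Delta,\alpha\cdot_ni:@_n\varphi$ / $\Gamma\stackrel{\mathcal{T}}{\Rightarrow}\Delta,\alpha:@_n\Box\varphi$, $i$ fresh in the conclusion; $(\Box L)$ $\beta:@_n\varphi,\Gamma\Rightarrow\Delta$ / $\alpha:@_n\Box\varphi,\Gamma\Rightarrow\Delta$, $\beta$ an $n$-child of $\alpha$; $(w\mathsf{lab})$ $\Gamma\stackrel{\mathcal{T}}{\Rightarrow}\Delta$ / $\Gamma\stackrel{\mathcal{T}\cup\{\alpha\}}{\Rightarrow}\Delta$ if $\mathcal{T}\cup\{\alpha\}$ is a tree; $(Cut)$ $\Gamma\Rightarrow\Delta,\alpha:@_n\varphi$ and $\alpha:@_n\varphi,\Pi\Rightarrow\Sigma$ / $\Gamma,\Pi\Rightarrow\Delta,\Sigma$. Hilbert system $\mathsf{H}\mathbf{EFL}$. Necessity forms: $\#$; $\varphi\to L$; $@_n\Box L$ for necessity form $L$; $L(\varphi)$ replaces $\#$ by $\varphi$. Axioms ($p,q\in\mathsf{Prop}$, $n,m\in\mathsf{Nom}$): propositional tautologies; $\Box(p\to q)\to(\Box p\to\Box q)$; $\mathsf{F}(p\to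 q)\to(\mathsf{F}p\to\mathsf{F}q)$; $@_n(p\to q)\to(@_np\to@_nq)$; $@_nn$; $\neg@_np\leftrightarrow@_n\neg p$; $@_np\to(n\to p)$; $@_n@_mp\to@_mp$; $@_np\to\mathsf{F}@_np$; $@_n\Box@_np\leftrightarrow@_n\Box p$; $@_nm\to\Box@_nm$; $\neg@_nm\to\Box\neg@_nm$. Rules: modus ponens; from $\varphi$ infer $\Box\varphi$, $\mathsf{F}\varphi$, $@_n\varphi$; uniform substitution; from $n\to\varphi$ infer $\varphi$ if $n$ does not occur in $\varphi$; from $L(@_n\langle\mathsf{F}\rangle m\to@_m\varphi)$ infer $L(@_n\mathsf{F}\varphi)$ if $m$ does not occur in $L(@_n\mathsf{F}\varphi)$. Formulaic translation. For a set $\Theta$ of labelled formulas and label $\alpha$, $\Theta_\alpha:=\{\varphi:\alpha:\varphi\in\Theta\}$. For $\alpha\in\mathcal{T}$, $[\![\Gamma\stackrel{\mathcal{T}}{\Rightarrow}\Delta]\!]_\alpha := \bigwedge\Gamma_\alpha\to\bigvee\big(\Delta_\alpha\cup\{@_{n_1}\Box[\![\Gamma\stackrel{\mathcal{T}}{\Rightarrow}\Delta]\!]_{\beta_1},\dots,@_{n_k}\Box[\![\Gamma\stackrel{\mathcal{T}}{\Rightarrow}\Delta]\!]_{\beta_k}\}\big)$, where $\beta_1,\dots,\beta_k$ enumerate all children of $\alpha$ in $\mathcal{T}$, $\beta_j$ being an $n_j$-child, $\bigwedge\emptyset:=\top$, $\bigvee\emptyset:=\bot$. *)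

theory Defs
  imports Main "HOL-Library.FSet"
begin

type_synonym nom = nat

datatype fm =
    Nom nom
  | Pro nat
  | Bot
  | Imp fm fm
  | At nom fm
  | Fr fm
  | Box fm

abbreviation Neg :: "fm \<Rightarrow> fm" where "Neg \<phi> \<equiv> Imp \<phi> Bot"
abbreviation Top :: fm where "Top \<equiv> Neg Bot"
abbreviation And :: "fm \<Rightarrow> fm \<Rightarrow> fm" where "And \<phi> \<psi> \<equiv> Neg (Imp \<phi> (Neg \<psi>))"
abbreviation Or :: "fm \<Rightarrow> fm \<Rightarrow> fm" where "Or \<phi> \<psi> \<equiv> Imp (Neg \<phi>) \<psi>"
abbreviation Iff :: "fm \<Rightarrow> fm \<Rightarrow> fm" where "Iff \<phi> \<psi> \<equiv> And (Imp \<phi> \<psi>) (Imp \<psi> \<phi>)"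
abbreviation DiaF :: "fm \<Rightarrow> fm" where "DiaF \<phi> \<equiv> Neg (Fr (Neg \<phi>))"

primrec noms :: "fm \<Rightarrow> nom set" where
  "noms (Nom n) = {n}"
| "noms (Pro p) = {}"
| "noms Bot = {}"
| "noms (Imp \<phi> \<psi>) = noms \<phi> \<union> noms \<psi>"
| "noms (At n \<phi>) = insert n (noms \<phi>)"
| "noms (Fr \<phi>) = noms \<phi>"
| "noms (Box \<phi>) = noms \<phi>"

primrec usubst :: "(nat \<Rightarrow> fm) \<Rightarrow> (nom \<Rightarrow> nom) \<Rightarrow> fm \<Rightarrow> fm" where
  "usubst \<sigma> \<rho> (Nom n) = Nom (\<rho> n)"
| "usubst \<sigma> \<rho> (Pro p) = \<sigma> p"
| "usubst \<sigma> \<rho> Bot = Bot"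
| "usubst \<sigma> \<rho> (Imp \<phi> \<psi>) = Imp (usubst \<sigma> \<rho> \<phi>) (usubst \<sigma> \<rho> \<psi>)"
| "usubst \<sigma> \<rho> (At n \<phi>) = At (\<rho> n) (usubst \<sigma> \<rho> \<phi>)"
| "usubst \<sigma> \<rho> (Fr \<phi>) = Fr (usubst \<sigma> \<rho> \<phi>)"
| "usubst \<sigma> \<rho> (Box \<phi>) = Box (usubst \<sigma> \<rho> \<phi>)"

text \<open>\<open>nsubst \<phi> m k\<close> is \<open>\<phi>[m/k]\<close>: the nominal \<open>k\<close> is replaced by \<open>m\<close>.\<close>

definition nsubst :: "fm \<Rightarrow> nom \<Rightarrow> nom \<Rightarrow> fm" where
  "nsubst \<phi> m k = usubst Pro (id(k := m)) \<phi>"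

definition at_prefixed :: "fm \<Rightarrow> bool" where
  "at_prefixed \<phi> \<longleftrightarrow> (\<exists>n \<psi>. \<phi> = At n \<psi>)"


datatype label = Root nat | Child label nom nat

primrec label_noms :: "label \<Rightarrow> nom set" where
  "label_noms (Root i) = {}"
| "label_noms (Child \<alpha> n i) = insert n (label_noms \<alpha>)"

primrec label_nats :: "label \<Rightarrow> nat set" where
  "label_nats (Root i) = {i}"
| "label_nats (Child \<alpha> n i) = insert i (label_nats \<alpha>)"

definition tree :: "label set \<Rightarrow> bool" where
  "tree T \<longleftrightarrow> (\<exists>!i. Root i \<in> T) \<and> (\<forall>\<alpha> n i. Child \<alpha> n i \<in> T \<longrightarrow> \<alpha> \<in> T)"

type_synonym lfm = "label \<times> fm"

text \<open>A sequent is given by its three components \<open>\<Gamma>\<close>, \<open>T\<close>, \<open>\<Delta>\<close>, in this order.\<close>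

definition tree_sequent :: "lfm fset \<Rightarrow> label fset \<Rightarrow> lfm fset \<Rightarrow> bool" where
  "tree_sequent \<Gamma> T \<Delta> \<longleftrightarrow>
     tree (fset T) \<and> (\<forall>(\<alpha>, \<phi>) \<in> fset \<Gamma> \<union> fset \<Delta>. \<alpha> |\<in>| T \<and> at_prefixed \<phi>)"

definition seq_noms :: "lfm fset \<Rightarrow> label fset \<Rightarrow> lfm fset \<Rightarrow> nom set" where
  "seq_noms \<Gamma> T \<Delta> =
     (\<Union>\<alpha> \<in> fset T. label_noms \<alpha>) \<union> (\<Union>(\<alpha>, \<phi>) \<in> fset \<Gamma> \<union> fset \<Delta>. label_noms \<alpha> \<union> noms \<phi>)"

definition seq_nats :: "lfm fset \<Rightarrow> label fset \<Rightarrow> lfm fset \<Rightarrow> nat set" where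
  "seq_nats \<Gamma> T \<Delta> =
     (\<Union>\<alpha> \<in> fset T. label_nats \<alpha>) \<union> (\<Union>(\<alpha>, \<phi>) \<in> fset \<Gamma> \<union> fset \<Delta>. label_nats \<alpha>)"

text \<open>Each rule requires its conclusion to be a tree sequent; by induction so is every
  premise. This also yields the membership of all mentioned labels in the tree.\<close>

inductive TEFL :: "lfm fset \<Rightarrow> label fset \<Rightarrow> lfm fset \<Rightarrow> bool" where
  init_bot: "tree_sequent (finsert (\<alpha>, At n Bot) \<Gamma>) T \<Delta> \<Longrightarrow>
    TEFL (finsert (\<alpha>, At n Bot) \<Gamma>) T \<Delta>"
| init_id: "tree_sequent (finsert (\<alpha>, At n \<phi>) \<Gamma>) T (finsert (\<alpha>, At n \<phi>) \<Delta>) \<Longrightarrow>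
    TEFL (finsert (\<alpha>, At n \<phi>) \<Gamma>) T (finsert (\<alpha>, At n \<phi>) \<Delta>)"
| rep1: "TEFL (finsert (\<alpha>, At n (Nom m)) (finsert (\<alpha>, nsubst \<phi> n k) \<Gamma>)) T \<Delta> \<Longrightarrow>
    tree_sequent (finsert (\<alpha>, At n (Nom m)) (finsert (\<alpha>, nsubst \<phi> m k) \<Gamma>)) T \<Delta> \<Longrightarrow>
    TEFL (finsert (\<alpha>, At n (Nom m)) (finsert (\<alpha>, nsubst \<phi> m k) \<Gamma>)) T \<Delta>"
| rep2: "TEFL (finsert (\<alpha>, At n (Nom m)) (finsert (\<alpha>, nsubst \<phi> m k) \<Gamma>)) T \<Delta> \<Longrightarrow>
    tree_sequent (finsert (\<alpha>, At n (Nom m)) (finsert (\<alpha>, nsubst \<phi> n k) \<Gamma>)) T \<Delta> \<Longrightarrow>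
    TEFL (finsert (\<alpha>, At n (Nom m)) (finsert (\<alpha>, nsubst \<phi> n k) \<Gamma>)) T \<Delta>"
| ref: "TEFL (finsert (\<alpha>, At n (Nom n)) \<Gamma>) T \<Delta> \<Longrightarrow>
    tree_sequent \<Gamma> T \<Delta> \<Longrightarrow>
    TEFL \<Gamma> T \<Delta>"
| rigid: "TEFL (finsert (\<beta>, At n (Nom m)) \<Gamma>) T \<Delta> \<Longrightarrow>
    tree_sequent (finsert (\<alpha>, At n (Nom m)) \<Gamma>) T \<Delta> \<Longrightarrow>
    TEFL (finsert (\<alpha>, At n (Nom m)) \<Gamma>) T \<Delta>"
| ImpR: "TEFL (finsert (\<alpha>, At n \<phi>) \<Gamma>) T (finsert (\<alpha>, At n \<psi>) \<Delta>) \<Longrightarrow>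
    tree_sequent \<Gamma> T (finsert (\<alpha>, At n (Imp \<phi> \<psi>)) \<Delta>) \<Longrightarrow>
    TEFL \<Gamma> T (finsert (\<alpha>, At n (Imp \<phi> \<psi>)) \<Delta>)"
| ImpL: "TEFL \<Gamma> T (finsert (\<alpha>, At n \<phi>) \<Delta>) \<Longrightarrow>
    TEFL (finsert (\<alpha>, At n \<psi>) \<Gamma>) T \<Delta> \<Longrightarrow>
    tree_sequent (finsert (\<alpha>, At n (Imp \<phi> \<psi>)) \<Gamma>) T \<Delta> \<Longrightarrow>
    TEFL (finsert (\<alpha>, At n (Imp \<phi> \<psi>)) \<Gamma>) T \<Delta>"
| AtR: "TEFL \<Gamma> T (finsert (\<alpha>, At m \<phi>) \<Delta>) \<Longrightarrow>
    tree_sequent \<Gamma> T (finsert (\<alpha>, At n (At m \<phi>)) \<Delta>) \<Longrightarrow>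
    TEFL \<Gamma> T (finsert (\<alpha>, At n (At m \<phi>)) \<Delta>)"
| AtL: "TEFL (finsert (\<alpha>, At m \<phi>) \<Gamma>) T \<Delta> \<Longrightarrow>
    tree_sequent (finsert (\<alpha>, At n (At m \<phi>)) \<Gamma>) T \<Delta> \<Longrightarrow>
    TEFL (finsert (\<alpha>, At n (At m \<phi>)) \<Gamma>) T \<Delta>"
| FR: "TEFL (finsert (\<alpha>, At n (DiaF (Nom m))) \<Gamma>) T (finsert (\<alpha>, At m \<phi>) \<Delta>) \<Longrightarrow>
    m \<notin> seq_noms \<Gamma> T (finsert (\<alpha>, At n (Fr \<phi>)) \<Delta>) \<Longrightarrow>
    tree_sequent \<Gamma> T (finsert (\<alpha>, At n (Fr \<phi>)) \<Delta>) \<Longrightarrow>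
    TEFL \<Gamma> T (finsert (\<alpha>, At n (Fr \<phi>)) \<Delta>)"
| FL: "TEFL \<Gamma> T (finsert (\<alpha>, At n (DiaF (Nom m))) \<Delta>) \<Longrightarrow>
    TEFL (finsert (\<alpha>, At m \<phi>) \<Gamma>) T \<Delta> \<Longrightarrow>
    tree_sequent (finsert (\<alpha>, At n (Fr \<phi>)) \<Gamma>) T \<Delta> \<Longrightarrow>
    TEFL (finsert (\<alpha>, At n (Fr \<phi>)) \<Gamma>) T \<Delta>"
| BoxR: "TEFL \<Gamma> (finsert (Child \<alpha> n i) T) (finsert (Child \<alpha> n i, At n \<phi>) \<Delta>) \<Longrightarrow>
    i \<notin> seq_nats \<Gamma> T (finsert (\<alpha>, At n (Box \<phi>)) \<Delta>) \<Longrightarrow>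
    tree_sequent \<Gamma> T (finsert (\<alpha>, At n (Box \<phi>)) \<Delta>) \<Longrightarrow>
    TEFL \<Gamma> T (finsert (\<alpha>, At n (Box \<phi>)) \<Delta>)"
| BoxL: "TEFL (finsert (Child \<alpha> n i, At n \<phi>) \<Gamma>) T \<Delta> \<Longrightarrow>
    tree_sequent (finsert (\<alpha>, At n (Box \<phi>)) \<Gamma>) T \<Delta> \<Longrightarrow>
    TEFL (finsert (\<alpha>, At n (Box \<phi>)) \<Gamma>) T \<Delta>"
| wlab: "TEFL \<Gamma> T \<Delta> \<Longrightarrow>
    tree_sequent \<Gamma> (finsert \<alpha> T) \<Delta> \<Longrightarrow>
    TEFL \<Gamma> (finsert \<alpha> T) \<Delta>"
| Cut: "TEFL \<Gamma> T (finsert (\<alpha>, At n \<phi>) \<Delta>) \<Longrightarrow>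
    TEFL (finsert (\<alpha>, At n \<phi>) \<Pi>) T \<Sigma> \<Longrightarrow>
    tree_sequent (\<Gamma> |\<union>| \<Pi>) T (\<Delta> |\<union>| \<Sigma>) \<Longrightarrow>
    TEFL (\<Gamma> |\<union>| \<Pi>) T (\<Delta> |\<union>| \<Sigma>)"

lemma TEFL_tree_sequent: "TEFL \<Gamma> T \<Delta> \<Longrightarrow> tree_sequent \<Gamma> T \<Delta>"
  by (induction rule: TEFL.induct) assumption+


text \<open>Formulas not built by \<open>Bot\<close> or \<open>Imp\<close> count as propositional atoms.\<close>

fun peval :: "(fm \<Rightarrow> bool) \<Rightarrow> fm \<Rightarrow> bool" where
  "peval v Bot = False"
| "peval v (Imp \<phi> \<psi>) = (peval v \<phi> \<longrightarrow> peval v \<psi>)"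
| "peval v \<phi> = v \<phi>"

definition tautology :: "fm \<Rightarrow> bool" where
  "tautology \<phi> \<longleftrightarrow> (\<forall>v. peval v \<phi>)"

datatype nform = Hash | ImpNF fm nform | AtBoxNF nom nform

primrec plug :: "nform \<Rightarrow> fm \<Rightarrow> fm" where
  "plug Hash \<phi> = \<phi>"
| "plug (ImpNF \<psi> L) \<phi> = Imp \<psi> (plug L \<phi>)"
| "plug (AtBoxNF n L) \<phi> = At n (Box (plug L \<phi>))"

inductive HEFL :: "fm \<Rightarrow> bool" where
  Taut: "tautology \<phi> \<Longrightarrow> HEFL \<phi>"
| K_Box: "HEFL (Imp (Box (Imp (Pro p) (Pro q))) (Imp (Box (Pro p)) (Box (Pro q))))"
| K_F: "HEFL (Imp (Fr (Imp (Pro p) (Pro q))) (Imp (Fr (Pro p)) (Fr (Pro q))))"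
| K_At: "HEFL (Imp (At n (Imp (Pro p) (Pro q))) (Imp (At n (Pro p)) (At n (Pro q))))"
| At_refl: "HEFL (At n (Nom n))"
| At_selfdual: "HEFL (Iff (Neg (At n (Pro p))) (At n (Neg (Pro p))))"
| At_elim: "HEFL (Imp (At n (Pro p)) (Imp (Nom n) (Pro p)))"
| At_agree: "HEFL (Imp (At n (At m (Pro p))) (At m (Pro p)))"
| At_back: "HEFL (Imp (At n (Pro p)) (Fr (At n (Pro p))))"
| At_Box_At: "HEFL (Iff (At n (Box (At n (Pro p)))) (At n (Box (Pro p))))"
| Rigid_eq: "HEFL (Imp (At n (Nom m)) (Box (At n (Nom m))))"
| Rigid_neq: "HEFL (Imp (Neg (At n (Nom m))) (Box (Neg (At n (Nom m)))))"
| MP: "HEFL (Imp \<phi> \<psi>) \<Longrightarrow> HEFL \<phi> \<Longrightarrow> HEFL \<psi>"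
| Nec_Box: "HEFL \<phi> \<Longrightarrow> HEFL (Box \<phi>)"
| Nec_F: "HEFL \<phi> \<Longrightarrow> HEFL (Fr \<phi>)"
| Nec_At: "HEFL \<phi> \<Longrightarrow> HEFL (At n \<phi>)"
| US: "HEFL \<phi> \<Longrightarrow> HEFL (usubst \<sigma> \<rho> \<phi>)"
| Name: "HEFL (Imp (Nom n) \<phi>) \<Longrightarrow> n \<notin> noms \<phi> \<Longrightarrow> HEFL \<phi>"
| BG: "HEFL (plug L (Imp (At n (DiaF (Nom m))) (At m \<phi>))) \<Longrightarrow>
    m \<notin> noms (plug L (At n (Fr \<phi>))) \<Longrightarrow> HEFL (plug L (At n (Fr \<phi>)))"


fun conj_list :: "fm list \<Rightarrow> fm" where
  "conj_list [] = Top"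
| "conj_list [\<phi>] = \<phi>"
| "conj_list (\<phi> # \<psi> # \<phi>s) = And \<phi> (conj_list (\<psi> # \<phi>s))"

fun disj_list :: "fm list \<Rightarrow> fm" where
  "disj_list [] = Bot"
| "disj_list [\<phi>] = \<phi>"
| "disj_list (\<phi> # \<psi> # \<phi>s) = Or \<phi> (disj_list (\<psi> # \<phi>s))"

text \<open>Conjunctions and disjunctions of finite sets of formulas are formed along an
  unspecified repetition-free enumeration of the set.\<close>

definition enum_of :: "fm set \<Rightarrow> fm list" where
  "enum_of A = (SOME \<phi>s. set \<phi>s = A \<and> distinct \<phi>s)"

lemma enum_of: "finite A \<Longrightarrow> set (enum_of A) = A \<and> distinct (enum_of A)"
  unfolding enum_of_def by (rule someI_ex) (rule finite_distinct_list)

definition BigAnd :: "fm set \<Rightarrow> fm" where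
  "BigAnd A = conj_list (enum_of A)"

definition BigOr :: "fm set \<Rightarrow> fm" where
  "BigOr A = disj_list (enum_of A)"

definition fms_at :: "lfm fset \<Rightarrow> label \<Rightarrow> fm set" where
  "fms_at \<Theta> \<alpha> = {\<phi>. (\<alpha>, \<phi>) |\<in>| \<Theta>}"

function transl :: "lfm fset \<Rightarrow> label fset \<Rightarrow> lfm fset \<Rightarrow> label \<Rightarrow> fm" where
  "transl \<Gamma> T \<Delta> \<alpha> =
     Imp (BigAnd (fms_at \<Gamma> \<alpha>))
         (BigOr (fms_at \<Delta> \<alpha> \<union>
            (\<lambda>(n, i). At n (Box (transl \<Gamma> T \<Delta> (Child \<alpha> n i)))) ` {(n, i). Child \<alpha> n i |\<in>| T}))"
  by pat_completeness auto
termination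
proof (relation "measure (\<lambda>(\<Gamma>, T, \<Delta>, \<alpha>). card {\<beta> \<in> fset T. size \<alpha> < size \<beta>})", goal_cases)
  case 1
  show ?case by simp
next
  case (2 \<Gamma> T \<Delta> \<alpha> x n i)
  let ?A = "\<lambda>\<alpha>. {\<beta> \<in> fset T. size \<alpha> < size \<beta>}"
  have "Child \<alpha> n i \<in> ?A \<alpha>" "Child \<alpha> n i \<notin> ?A (Child \<alpha> n i)" using 2 by auto
  moreover have "?A (Child \<alpha> n i) \<subseteq> ?A \<alpha>" by auto
  ultimately have "?A (Child \<alpha> n i) \<subset> ?A \<alpha>" by blast
  then have "card (?A (Child \<alpha> n i)) < card (?A \<alpha>)" by (intro psubset_card_mono) simp_all
  then show ?case by (simp only: in_measure prod.case)
qed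

declare transl.simps [simp del]

end

theory Submission
  imports Defs
begin

text \<open>
  Along the path from the root to a label \<open>\<alpha>\<close>, the translation at the root is provably
  equivalent to \<open>L(\<psi>)\<close> for a necessity form \<open>L\<close>, where \<open>\<psi>\<close> is the translation at \<open>\<alpha>\<close>; the form \<open>L\<close>
  only depends on what lies outside the subtree at \<open>\<alpha>\<close>. Since necessity forms are
  monotone, every rule acting at \<open>\<alpha>\<close> and its children reduces to an implication between
  translations at \<open>\<alpha>\<close>, and the rule for \<open>\<F>\<close> on the right becomes the last rule of the Hilbert
  system. The rigidity rule instead uses that both \<open>@\<^sub>nm\<close> and its negation are preserved by
  every \<open>@\<^sub>l\<box>\<close>, so either of them can be carried from the root to any label.
\<close>

section \<open>The Hilbert system\<close>

text \<open>Hilbert derivability is closed under propositional consequence, so propositional steps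
  can be settled by evaluating formulas. The premises are discharged one at a time into an
  implication and then removed by modus ponens.\<close>

lemma HEFL_conseq:
  assumes "finite S" "\<And>A. A \<in> S \<Longrightarrow> HEFL A"
    and "\<And>v. (\<And>A. A \<in> S \<Longrightarrow> peval v A) \<Longrightarrow> peval v B"
  shows "HEFL B"
  using assms
proof (induction S arbitrary: B rule: finite_induct)
  case empty
  then show ?case by (auto intro: HEFL.Taut simp: tautology_def)
next
  case (insert A S)
  have "HEFL (Imp A B)"
    by (rule insert.IH) (use insert.prems in auto)
  then show ?case
    using insert.prems(1) by (auto intro: HEFL.MP)
qed

lemma HEFL_conseq0: "(\<And>v. peval v B) \<Longrightarrow> HEFL B"
  by (rule HEFL_conseq[of "{}"]) auto

lemma HEFL_conseq1: "HEFL A \<Longrightarrow> (\<And>v. peval v A \<Longrightarrow> peval v B) \<Longrightarrow> HEFL B"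
  by (rule HEFL_conseq[of "{A}"]) auto

lemma HEFL_conseq2:
  "HEFL A1 \<Longrightarrow> HEFL A2 \<Longrightarrow> (\<And>v. peval v A1 \<Longrightarrow> peval v A2 \<Longrightarrow> peval v B) \<Longrightarrow> HEFL B"
  by (rule HEFL_conseq[of "{A1, A2}"]) auto

lemma HEFL_conseq3:
  "HEFL A1 \<Longrightarrow> HEFL A2 \<Longrightarrow> HEFL A3 \<Longrightarrow>
    (\<And>v. peval v A1 \<Longrightarrow> peval v A2 \<Longrightarrow> peval v A3 \<Longrightarrow> peval v B) \<Longrightarrow> HEFL B"
  by (rule HEFL_conseq[of "{A1, A2, A3}"]) auto

text \<open>The axioms mention propositional variables only. Substituting arbitrary formulas for
  them, with nominals fixed, turns this axiom and the following ones into schemes.\<close>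

lemma HEFL_Box_K: "HEFL (Imp (Box (Imp A B)) (Imp (Box A) (Box B)))"
  using HEFL.US[OF HEFL.K_Box[of 0 1], of "Pro(0 := A, 1 := B)" id] by simp

lemma HEFL_F_K: "HEFL (Imp (Fr (Imp A B)) (Imp (Fr A) (Fr B)))"
  using HEFL.US[OF HEFL.K_F[of 0 1], of "Pro(0 := A, 1 := B)" id] by simp

lemma HEFL_At_K: "HEFL (Imp (At n (Imp A B)) (Imp (At n A) (At n B)))"
  using HEFL.US[OF HEFL.K_At[of n 0 1], of "Pro(0 := A, 1 := B)" id] by simp

lemma HEFL_At_Neg: "HEFL (Iff (Neg (At n A)) (At n (Neg A)))"
  using HEFL.US[OF HEFL.At_selfdual[of n 0], of "Pro(0 := A)" id] by simp

lemma HEFL_At_elim: "HEFL (Imp (At n A) (Imp (Nom n) A))"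
  using HEFL.US[OF HEFL.At_elim[of n 0], of "Pro(0 := A)" id] by simp

lemma HEFL_At_agree: "HEFL (Imp (At n (At m A)) (At m A))"
  using HEFL.US[OF HEFL.At_agree[of n m 0], of "Pro(0 := A)" id] by simp

lemma HEFL_At_back: "HEFL (Imp (At n A) (Fr (At n A)))"
  using HEFL.US[OF HEFL.At_back[of n 0], of "Pro(0 := A)" id] by simp

lemma HEFL_At_Box_At: "HEFL (Iff (At n (Box (At n A))) (At n (Box A)))"
  using HEFL.US[OF HEFL.At_Box_At[of n 0], of "Pro(0 := A)" id] by simp

lemma HEFL_Box_mono: "HEFL (Imp A B) \<Longrightarrow> HEFL (Imp (Box A) (Box B))"
  by (rule HEFL.MP[OF HEFL_Box_K HEFL.Nec_Box])

lemma HEFL_F_mono: "HEFL (Imp A B) \<Longrightarrow> HEFL (Imp (Fr A) (Fr B))"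
  by (rule HEFL.MP[OF HEFL_F_K HEFL.Nec_F])

lemma HEFL_At_mono: "HEFL (Imp A B) \<Longrightarrow> HEFL (Imp (At n A) (At n B))"
  by (rule HEFL.MP[OF HEFL_At_K HEFL.Nec_At])

lemma HEFL_Box_mono2: "HEFL (Imp A (Imp B C)) \<Longrightarrow> HEFL (Imp (Box A) (Imp (Box B) (Box C)))"
  by (drule HEFL_Box_mono, erule HEFL_conseq2[OF HEFL_Box_K[of B C]]) auto

lemma HEFL_F_mono2: "HEFL (Imp A (Imp B C)) \<Longrightarrow> HEFL (Imp (Fr A) (Imp (Fr B) (Fr C)))"
  by (drule HEFL_F_mono, erule HEFL_conseq2[OF HEFL_F_K[of B C]]) auto

lemma HEFL_At_mono2:
  "HEFL (Imp A (Imp B C)) \<Longrightarrow> HEFL (Imp (At n A) (Imp (At n B) (At n C)))"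
  by (drule HEFL_At_mono[where n = n], erule HEFL_conseq2[OF HEFL_At_K[of n B C]]) auto

lemma HEFL_AtBox_mono2:
  "HEFL (Imp A (Imp B C)) \<Longrightarrow>
    HEFL (Imp (At n (Box A)) (Imp (At n (Box B)) (At n (Box C))))"
  by (intro HEFL_At_mono2 HEFL_Box_mono2)

lemma HEFL_AtBox_mono: "HEFL (Imp A B) \<Longrightarrow> HEFL (Imp (At n (Box A)) (At n (Box B)))"
  by (intro HEFL_At_mono HEFL_Box_mono)

section \<open>Derived laws of \<open>At\<close> and of equality between nominals\<close>

lemma HEFL_At_Bot: "HEFL (Neg (At n Bot))"
proof -
  have "HEFL (At n Top)" by (intro HEFL.Nec_At HEFL_conseq0) auto
  then show ?thesis by (rule HEFL_conseq2[OF HEFL_At_Neg[of n Bot]]) auto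
qed

text \<open>The converse of K is due to self-duality: if \<open>At n A\<close> fails, then
  \<open>At n (Neg A)\<close> holds, and \<open>Neg A\<close> implies
  \<open>Imp A B\<close>.\<close>

lemma HEFL_At_Imp: "HEFL (Iff (At n (Imp A B)) (Imp (At n A) (At n B)))"
proof -
  have "HEFL (Imp (At n (Neg A)) (At n (Imp A B)))"
    by (intro HEFL_At_mono HEFL_conseq0) auto
  moreover have "HEFL (Imp (At n B) (At n (Imp A B)))"
    by (intro HEFL_At_mono HEFL_conseq0) auto
  ultimately have "HEFL (Imp (Imp (At n A) (At n B)) (At n (Imp A B)))"
    by (rule HEFL_conseq3[OF HEFL_At_Neg[of n A]]) auto
  then show ?thesis by (rule HEFL_conseq2[OF HEFL_At_K[of n A B]]) auto
qed

text \<open>The direction missing from the axioms is the agreement axiom for \<open>Neg A\<close>,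
  contraposed by self-duality of both operators.\<close>

lemma HEFL_At_At: "HEFL (Iff (At n (At m A)) (At m A))"
proof -
  have "HEFL (Imp (At n (Neg (At m A))) (At n (At m (Neg A))))"
    by (rule HEFL_At_mono, rule HEFL_conseq1[OF HEFL_At_Neg[of m A]]) auto
  then have "HEFL (Imp (At n (Neg (At m A))) (At m (Neg A)))"
    by (rule HEFL_conseq2[OF HEFL_At_agree[of n m "Neg A"]]) auto
  then have "HEFL (Imp (At m A) (At n (At m A)))"
    by (rule HEFL_conseq3[OF HEFL_At_Neg[of n "At m A"] HEFL_At_Neg[of m A]]) auto
  then show ?thesis by (rule HEFL_conseq2[OF HEFL_At_agree[of n m A]]) auto
qed

text \<open>The contrapositive of \<open>HEFL_At_elim\<close> for \<open>Neg A\<close>, by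
  self-duality.\<close>

lemma HEFL_At_intro: "HEFL (Imp (Nom n) (Imp A (At n A)))"
  by (rule HEFL_conseq2[OF HEFL_At_elim[of n "Neg A"] HEFL_At_Neg[of n A]]) auto

text \<open>\<open>HEFL_At_intro\<close> for \<open>m\<close> is applied under \<open>At n\<close>,
  and the resulting \<open>At n (At m A)\<close> collapses by agreement.\<close>

lemma HEFL_At_Nom_transfer: "HEFL (Imp (At n (Nom m)) (Imp (At n A) (At m A)))"
  by (rule HEFL_conseq2[OF HEFL_At_mono2[OF HEFL_At_intro[of m A], of n] HEFL_At_agree[of n m A]])
    auto

lemma HEFL_At_Nom_sym: "HEFL (Imp (At n (Nom m)) (At m (Nom n)))"
  by (rule HEFL_conseq2[OF HEFL_At_Nom_transfer[of n m "Nom n"] HEFL.At_refl[of n]]) auto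

lemma nsubst_Imp: "nsubst (Imp \<phi> \<psi>) m k = Imp (nsubst \<phi> m k) (nsubst \<psi> m k)"
  by (simp add: nsubst_def)

text \<open>An equality can be carried under every operator: under \<open>At\<close> by
  \<open>HEFL_At_At\<close>, under \<open>Fr\<close> by \<open>HEFL_At_back\<close>, under
  \<open>Box\<close> by rigidity. The induction hypothesis then applies inside the operator.\<close>

lemma HEFL_replacement:
  "HEFL (Imp (At n (Nom m)) (Iff (nsubst \<phi> n k) (nsubst \<phi> m k)))"
proof (induction \<phi>)
  case (Nom l)
  have "HEFL (Imp (At n (Nom m)) (Iff (Nom n) (Nom m)))"
    by (rule HEFL_conseq3[OF HEFL_At_Nom_sym[of n m] HEFL_At_elim[of n "Nom m"]
          HEFL_At_elim[of m "Nom n"]]) (unfold peval.simps, blast)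
  then show ?case
    by (cases "l = k") (simp_all add: nsubst_def HEFL_conseq0)
next
  case (Pro p)
  then show ?case by (intro HEFL_conseq0) (auto simp: nsubst_def)
next
  case Bot
  then show ?case by (intro HEFL_conseq0) (auto simp: nsubst_def)
next
  case (Imp \<phi> \<psi>)
  then show ?case by (rule HEFL_conseq2) (unfold nsubst_Imp peval.simps, blast)
next
  case (At l \<phi>)
  let ?A = "nsubst \<phi> n k" and ?B = "nsubst \<phi> m k" and ?e = "At n (Nom m)"
  \<comment> \<open>Stated for every \<open>j\<close>, because it is used at \<open>l\<close> and,
    when \<open>l = k\<close>, at \<open>n\<close>.\<close>
  have IH: "HEFL (Imp ?e (Iff (At j ?A) (At j ?B)))" for j
  proof -
    have "HEFL (Imp (At j ?e) (Imp (At j ?A) (At j ?B)))"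
      by (rule HEFL_At_mono2, rule HEFL_conseq1[OF At.IH])
      (unfold peval.simps, blast)
    moreover have "HEFL (Imp (At j ?e) (Imp (At j ?B) (At j ?A)))"
      by (rule HEFL_At_mono2, rule HEFL_conseq1[OF At.IH])
      (unfold peval.simps, blast)
    ultimately show ?thesis
      by (rule HEFL_conseq3[OF HEFL_At_At[of j n "Nom m"]])
      (unfold peval.simps, blast)
  qed
  \<comment> \<open>If \<open>l = k\<close>, the index of \<open>At\<close> is itself replaced, so
    the point of evaluation has to move from \<open>n\<close> to \<open>m\<close>.\<close>
  have "HEFL (Imp ?e (Iff (At n ?B) (At m ?B)))"
    by (rule HEFL_conseq3[OF HEFL_At_Nom_sym[of n m] HEFL_At_Nom_transfer[of n m ?B]
          HEFL_At_Nom_transfer[of m n ?B]]) (unfold peval.simps, blast)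
  then have "HEFL (Imp ?e (Iff (At n ?A) (At m ?B)))"
    by (rule HEFL_conseq2[OF IH[of n]])
      (unfold peval.simps, blast)
  with IH[of l] show ?case
    by (cases "l = k") (simp_all add: nsubst_def)
next
  case (Fr \<phi>)
  let ?A = "nsubst \<phi> n k" and ?B = "nsubst \<phi> m k" and ?e = "At n (Nom m)"
  have "HEFL (Imp (Fr ?e) (Imp (Fr ?A) (Fr ?B)))"
    by (rule HEFL_F_mono2, rule HEFL_conseq1[OF Fr.IH])
      (unfold peval.simps, blast)
  moreover have "HEFL (Imp (Fr ?e) (Imp (Fr ?B) (Fr ?A)))"
    by (rule HEFL_F_mono2, rule HEFL_conseq1[OF Fr.IH])
      (unfold peval.simps, blast)
  ultimately have "HEFL (Imp ?e (Iff (Fr ?A) (Fr ?B)))"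
    by (rule HEFL_conseq3[OF HEFL_At_back[of n "Nom m"]])
      (unfold peval.simps, blast)
  then show ?case by (simp add: nsubst_def)
next
  case (Box \<phi>)
  let ?A = "nsubst \<phi> n k" and ?B = "nsubst \<phi> m k" and ?e = "At n (Nom m)"
  have "HEFL (Imp (Box ?e) (Imp (Box ?A) (Box ?B)))"
    by (rule HEFL_Box_mono2, rule HEFL_conseq1[OF Box.IH])
      (unfold peval.simps, blast)
  moreover have "HEFL (Imp (Box ?e) (Imp (Box ?B) (Box ?A)))"
    by (rule HEFL_Box_mono2, rule HEFL_conseq1[OF Box.IH])
      (unfold peval.simps, blast)
  ultimately have "HEFL (Imp ?e (Iff (Box ?A) (Box ?B)))"
    by (rule HEFL_conseq3[OF HEFL.Rigid_eq[of n m]])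
      (unfold peval.simps, blast)
  then show ?case by (simp add: nsubst_def)
qed

text \<open>If \<open>A\<close> failed at \<open>m\<close>, this fact would hold at all friends by
  \<open>HEFL_At_back\<close>. A friend satisfying \<open>A\<close> could then not be
  \<open>m\<close>, so \<open>Fr A\<close> would contradict \<open>DiaF (Nom m)\<close>. This is the
  local content of the left rule for \<open>Fr\<close>.\<close>

lemma HEFL_At_F_elim: "HEFL (Imp (At n (Fr A)) (Imp (At n (DiaF (Nom m))) (At m A)))"
proof -
  have "HEFL (Imp (At m (Neg A)) (Imp A (Neg (Nom m))))"
    by (rule HEFL_conseq1[OF HEFL_At_elim[of m "Neg A"]])
      (unfold peval.simps, blast)
  then have "HEFL (Imp (Fr (At m (Neg A))) (Imp (Fr A) (Fr (Neg (Nom m)))))"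
    by (rule HEFL_F_mono2)
  then have "HEFL (Imp (Fr A) (Imp (DiaF (Nom m)) (At m A)))"
    by (rule HEFL_conseq3[OF HEFL_At_back[of m "Neg A"] HEFL_At_Neg[of m A]])
      (unfold peval.simps, blast)
  then have "HEFL (Imp (At n (Fr A)) (Imp (At n (DiaF (Nom m))) (At n (At m A))))"
    by (rule HEFL_At_mono2)
  then show ?thesis by (rule HEFL_conseq2[OF HEFL_At_agree[of n m A]])
      (unfold peval.simps, blast)
qed

text \<open>These are the formulas that can be passed from a label to each of its children, since a
  child enters the translation behind \<open>At l\<close> and \<open>Box\<close>.\<close>

definition persistent :: "fm \<Rightarrow> bool" where
  "persistent A \<longleftrightarrow> (\<forall>l. HEFL (Imp A (At l (Box A))))"

lemma persistent_eq: "persistent (At n (Nom m))"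
  unfolding persistent_def
proof
  fix l
  show "HEFL (Imp (At n (Nom m)) (At l (Box (At n (Nom m)))))"
    by (rule HEFL_conseq2[OF HEFL_At_At[of l n "Nom m"] HEFL_At_mono[OF HEFL.Rigid_eq[of n m], of l]])
      auto
qed

lemma persistent_neq: "persistent (Neg (At n (Nom m)))"
  unfolding persistent_def
proof
  fix l
  show "HEFL (Imp (Neg (At n (Nom m))) (At l (Box (Neg (At n (Nom m))))))"
    by (rule HEFL_conseq3[OF HEFL_At_At[of l n "Nom m"] HEFL_At_mono[OF HEFL.Rigid_neq[of n m], of l]
          HEFL_At_Neg[of l "At n (Nom m)"]])
      (unfold peval.simps, blast)
qed

section \<open>Necessity forms\<close>

primrec nf_comp :: "nform \<Rightarrow> nform \<Rightarrow> nform" where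
  "nf_comp Hash M = M"
| "nf_comp (ImpNF A L) M = ImpNF A (nf_comp L M)"
| "nf_comp (AtBoxNF n L) M = AtBoxNF n (nf_comp L M)"

lemma plug_nf_comp [simp]: "plug (nf_comp L M) A = plug L (plug M A)"
  by (induction L) auto

text \<open>\<open>Bot\<close> has no nominals, so \<open>noms (plug L Bot)\<close> serves as the
  set of nominals of \<open>L\<close> itself.\<close>

lemma noms_plug: "noms (plug L A) = noms (plug L Bot) \<union> noms A"
  by (induction L) auto

text \<open>A necessity form is a stack of implications and operators \<open>At n (Box _)\<close>,
  all of which distribute over implication. Two premises are allowed for the sake of the branching
  rules.\<close>

lemma plug_mono2:
  "HEFL (Imp A (Imp B C)) \<Longrightarrow> HEFL (Imp (plug L A) (Imp (plug L B) (plug L C)))"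
proof (induction L)
  case (ImpNF D L)
  show ?case by (rule HEFL_conseq1[OF ImpNF.IH[OF ImpNF.prems]]) auto
qed (auto intro: HEFL_AtBox_mono2)

lemma plug_mono: "HEFL (Imp A B) \<Longrightarrow> HEFL (Imp (plug L A) (plug L B))"
proof -
  assume "HEFL (Imp A B)"
  then have "HEFL (Imp A (Imp A B))" by (rule HEFL_conseq1) auto
  then show ?thesis using HEFL_conseq1[OF plug_mono2[of A A B L]] by simp
qed

text \<open>Persistence takes \<open>A\<close> through each modal layer of \<open>L\<close>, and an
  implication layer only adds a further antecedent.\<close>

lemma persistent_plug:
  assumes "persistent A" "HEFL (Imp A B)"
  shows "HEFL (Imp A (plug L B))"
proof (induction L)
  case Hash
  then show ?case using assms by simp
next
  case (ImpNF D L)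
  then show ?case by (rule HEFL_conseq1) auto
next
  case (AtBoxNF n L)
  have "HEFL (Imp A (At n (Box A)))" using assms(1) by (simp add: persistent_def)
  then show ?case
    by (rule HEFL_conseq2[OF HEFL_AtBox_mono[OF AtBoxNF, of n]]) auto
qed

section \<open>The formulaic translation\<close>

lemma finite_fms_at [simp]: "finite (fms_at \<Theta> \<alpha>)"
proof -
  have "fms_at \<Theta> \<alpha> \<subseteq> snd ` fset \<Theta>" by (force simp: fms_at_def)
  then show ?thesis by (rule finite_subset) simp
qed

lemma finite_children [simp]: "finite {(n, i). Child \<alpha> n i |\<in>| T}"
proof -
  have "(\<lambda>(n, i). Child \<alpha> n i) ` {(n, i). Child \<alpha> n i |\<in>| T} \<subseteq> fset T" by auto
  then have "finite ((\<lambda>(n, i). Child \<alpha> n i) ` {(n, i). Child \<alpha> n i |\<in>| T})"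
    by (rule finite_subset) simp
  then show ?thesis by (rule finite_imageD) (auto simp: inj_on_def)
qed

lemma peval_conj_list: "peval v (conj_list As) \<longleftrightarrow> (\<forall>A \<in> set As. peval v A)"
  by (induction As rule: conj_list.induct) auto

lemma peval_disj_list: "peval v (disj_list As) \<longleftrightarrow> (\<exists>A \<in> set As. peval v A)"
  by (induction As rule: disj_list.induct) auto

lemma noms_conj_list: "noms (conj_list As) = (\<Union>A \<in> set As. noms A)"
  by (induction As rule: conj_list.induct) auto

lemma noms_disj_list: "noms (disj_list As) = (\<Union>A \<in> set As. noms A)"
  by (induction As rule: disj_list.induct) auto

text \<open>One level of the translation, independent of the chosen enumerations. The contributions
  of the children are propositional atoms and are thus left to the valuation.\<close>

lemma peval_transl:
  "peval v (transl \<Gamma> T \<Delta> \<alpha>) \<longleftrightarrow>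
    ((\<forall>A \<in> fms_at \<Gamma> \<alpha>. peval v A) \<longrightarrow>
      (\<exists>A \<in> fms_at \<Delta> \<alpha>. peval v A) \<or>
      (\<exists>n i. Child \<alpha> n i |\<in>| T \<and> v (At n (Box (transl \<Gamma> T \<Delta> (Child \<alpha> n i))))))"
  by (subst transl.simps)
    (auto simp: BigAnd_def BigOr_def peval_conj_list peval_disj_list enum_of bex_Un)

lemma noms_transl_unfold:
  "noms (transl \<Gamma> T \<Delta> \<alpha>) = (\<Union>A \<in> fms_at \<Gamma> \<alpha> \<union> fms_at \<Delta> \<alpha>. noms A) \<union>
    (\<Union>(n, i) \<in> {(n, i). Child \<alpha> n i |\<in>| T}. insert n (noms (transl \<Gamma> T \<Delta> (Child \<alpha> n i))))"
  by (subst transl.simps)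
    (auto simp: BigAnd_def BigOr_def noms_conj_list noms_disj_list enum_of)

text \<open>Induction from the children to the parent, well-founded since \<open>T\<close> is
  finite. It is extracted from the termination proof of \<open>transl\<close>.\<close>

lemma transl_induct [case_names step]:
  assumes "\<And>\<alpha>. (\<And>n i. Child \<alpha> n i |\<in>| T \<Longrightarrow> P (Child \<alpha> n i)) \<Longrightarrow> P \<alpha>"
  shows "P \<alpha>"
proof -
  \<comment> \<open>The tree is pinned to \<open>T\<close> by an equation; the empty sets of
    formulas are placeholders.\<close>
  have "(\<lambda>\<Gamma> T' \<Delta> \<alpha>. T' = T \<longrightarrow> P \<alpha>) {||} T {||} \<alpha>"
    by (rule transl.induct) (use assms in auto)
  then show ?thesis by simp
qed

text \<open>Transfers freshness of a nominal for a sequent to its translation, as the right rule for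
  \<open>Fr\<close> requires.\<close>

lemma noms_transl: "noms (transl \<Gamma> T \<Delta> \<alpha>) \<subseteq> seq_noms \<Gamma> T \<Delta>"
proof (induction \<alpha> rule: transl_induct[of T])
  case (step \<alpha>)
  have "noms A \<subseteq> seq_noms \<Gamma> T \<Delta>" if "A \<in> fms_at \<Gamma> \<alpha> \<union> fms_at \<Delta> \<alpha>" for A
    using that by (force simp: seq_noms_def fms_at_def)
  moreover have "n \<in> seq_noms \<Gamma> T \<Delta>" if "Child \<alpha> n i |\<in>| T" for n i
    using that by (force simp: seq_noms_def)
  ultimately show ?case
    using step by (subst noms_transl_unfold) fast
qed

text \<open>More antecedents and more disjuncts weaken the formula at each label, and
  \<open>At n (Box _)\<close> preserves this on the way up.\<close>

lemma transl_weaken: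
  assumes "\<Gamma> |\<subseteq>| \<Gamma>'" "\<Delta> |\<subseteq>| \<Delta>'"
  shows "HEFL (Imp (transl \<Gamma> T \<Delta> \<alpha>) (transl \<Gamma>' T \<Delta>' \<alpha>))"
proof (induction \<alpha> rule: transl_induct[of T])
  case (step \<alpha>)
  \<comment> \<open>The modal implications at the children are supplied as premises, because
    propositional reasoning sees their two sides as unrelated atoms.\<close>
  let ?S = "(\<lambda>(n, i). Imp (At n (Box (transl \<Gamma> T \<Delta> (Child \<alpha> n i))))
    (At n (Box (transl \<Gamma>' T \<Delta>' (Child \<alpha> n i))))) ` {(n, i). Child \<alpha> n i |\<in>| T}"
  have sub: "fms_at \<Gamma> \<alpha> \<subseteq> fms_at \<Gamma>' \<alpha>" "fms_at \<Delta> \<alpha> \<subseteq> fms_at \<Delta>' \<alpha>"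
    using assms by (auto simp: fms_at_def)
  show ?case
  proof (rule HEFL_conseq[of ?S])
    show "HEFL A" if "A \<in> ?S" for A
      using that step by (auto intro: HEFL_AtBox_mono)
    show "peval v (Imp (transl \<Gamma> T \<Delta> \<alpha>) (transl \<Gamma>' T \<Delta>' \<alpha>))"
      if v: "\<And>A. A \<in> ?S \<Longrightarrow> peval v A" for v
    proof -
      have "v (At n (Box (transl \<Gamma>' T \<Delta>' (Child \<alpha> n i))))"
        if "Child \<alpha> n i |\<in>| T" "v (At n (Box (transl \<Gamma> T \<Delta> (Child \<alpha> n i))))" for n i
        using v[OF image_eqI[OF refl, of "(n, i)"]] that by simp
      then show ?thesis using sub by (simp add: peval_transl) blast
    qed
  qed simp
qed

lemma fms_at_finsert:
  "fms_at (finsert (\<beta>, A) \<Gamma>) \<alpha> = (if \<alpha> = \<beta> then insert A (fms_at \<Gamma> \<alpha>) else fms_at \<Gamma> \<alpha>)"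
  by (auto simp: fms_at_def)

text \<open>A persistent \<open>A\<close> assumed at \<alpha> travels down to \<beta> whenever
  \<beta> lies below \<alpha> in the tree, and there it replaces the labelled assumption.\<close>

lemma transl_discharge:
  assumes "persistent A"
  shows "HEFL (Imp A (Imp (transl (finsert (\<beta>, A) \<Gamma>) T \<Delta> \<alpha>) (transl \<Gamma> T \<Delta> \<alpha>)))"
proof (induction \<alpha> rule: transl_induct[of T])
  case (step \<alpha>)
  let ?B = "\<lambda>n i. At n (Box (transl (finsert (\<beta>, A) \<Gamma>) T \<Delta> (Child \<alpha> n i)))"
  let ?C = "\<lambda>n i. At n (Box (transl \<Gamma> T \<Delta> (Child \<alpha> n i)))"
  let ?S = "(\<lambda>(n, i). Imp A (Imp (?B n i) (?C n i))) ` {(n, i). Child \<alpha> n i |\<in>| T}"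
  show ?case
  proof (rule HEFL_conseq[of ?S])
    show "HEFL D" if "D \<in> ?S" for D
    proof -
      obtain n i where ni: "Child \<alpha> n i |\<in>| T" and D: "D = Imp A (Imp (?B n i) (?C n i))"
        using \<open>D \<in> ?S\<close> by auto
      have "HEFL (Imp A (At n (Box A)))"
        using assms by (simp add: persistent_def)
      then show ?thesis unfolding D
        by (rule HEFL_conseq2[OF HEFL_AtBox_mono2[OF step[OF ni], of n]]) auto
    qed
    show "peval v (Imp A (Imp (transl (finsert (\<beta>, A) \<Gamma>) T \<Delta> \<alpha>) (transl \<Gamma> T \<Delta> \<alpha>)))"
      if v: "\<And>D. D \<in> ?S \<Longrightarrow> peval v D" for v
    proof -
      have "v (?C n i)" if "Child \<alpha> n i |\<in>| T" "peval v A" "v (?B n i)" for n i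
        using v[OF image_eqI[OF refl, of "(n, i)"]] that by simp
      then show ?thesis by (simp add: peval_transl fms_at_finsert) blast
    qed
  qed simp
qed

section \<open>Subtrees and contexts\<close>

text \<open>The reflexive ancestor order: the labels \<beta> with
  \<open>anc \<alpha> \<beta>\<close> form the subtree at \<alpha>.\<close>

primrec anc :: "label \<Rightarrow> label \<Rightarrow> bool" where
  "anc \<alpha> (Root i) \<longleftrightarrow> \<alpha> = Root i"
| "anc \<alpha> (Child \<beta> n i) \<longleftrightarrow> \<alpha> = Child \<beta> n i \<or> anc \<alpha> \<beta>"

lemma anc_refl [simp]: "anc \<alpha> \<alpha>"
  by (cases \<alpha>) auto

lemma anc_size: "anc \<alpha> \<beta> \<Longrightarrow> size \<alpha> \<le> size \<beta>"
  by (induction \<beta>) auto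

lemma not_anc_Child [simp]: "\<not> anc (Child \<alpha> n i) \<alpha>"
  using anc_size by fastforce

lemma not_anc_grandchild [simp]: "\<not> anc (Child (Child \<alpha> n i) m j) \<alpha>"
  using anc_size by fastforce

lemma Child_neq [simp]: "Child \<alpha> n i \<noteq> \<alpha>" "\<alpha> \<noteq> Child \<alpha> n i"
  by (metis not_anc_Child anc_refl)+

lemma anc_trans: "anc \<alpha> \<beta> \<Longrightarrow> anc \<beta> \<gamma> \<Longrightarrow> anc \<alpha> \<gamma>"
  by (induction \<gamma>) auto

lemma anc_ChildD: "anc (Child \<alpha> n i) \<beta> \<Longrightarrow> anc \<alpha> \<beta> \<and> \<alpha> \<noteq> \<beta>"
  using anc_trans[of \<alpha> "Child \<alpha> n i" \<beta>] by auto

text \<open>The ancestors of a label form a chain, so the subtrees at distinct siblings are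
  disjoint.\<close>

lemma anc_siblings:
  "anc (Child \<alpha> n i) \<beta> \<Longrightarrow> anc (Child \<alpha> m j) \<beta> \<Longrightarrow> n = m \<and> i = j"
  by (induction \<beta>) auto

text \<open>The recursion only descends from \<alpha>. The trees are compared strictly below
  \<alpha>, since only membership of descendants is ever inspected.\<close>

lemma transl_cong:
  assumes "\<And>\<beta>. anc \<alpha> \<beta> \<Longrightarrow> fms_at \<Gamma> \<beta> = fms_at \<Gamma>' \<beta>"
    and "\<And>\<beta>. anc \<alpha> \<beta> \<Longrightarrow> fms_at \<Delta> \<beta> = fms_at \<Delta>' \<beta>"
    and "\<And>\<beta>. anc \<alpha> \<beta> \<Longrightarrow> \<beta> \<noteq> \<alpha> \<Longrightarrow> \<beta> |\<in>| T \<longleftrightarrow> \<beta> |\<in>| T'"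
  shows "transl \<Gamma> T \<Delta> \<alpha> = transl \<Gamma>' T' \<Delta>' \<alpha>"
  using assms
proof (induction \<alpha> rule: transl_induct[of T])
  case (step \<alpha>)
  have kids: "{(n, i). Child \<alpha> n i |\<in>| T} = {(n, i). Child \<alpha> n i |\<in>| T'}"
    using step.prems(3) by auto
  have "transl \<Gamma> T \<Delta> (Child \<alpha> n i) = transl \<Gamma>' T' \<Delta>' (Child \<alpha> n i)"
    if "Child \<alpha> n i |\<in>| T" for n i
    by (rule step.IH[OF that]) (use step.prems anc_ChildD in blast)+
  then have "(\<lambda>(n, i). At n (Box (transl \<Gamma> T \<Delta> (Child \<alpha> n i)))) ` {(n, i). Child \<alpha> n i |\<in>| T}
      = (\<lambda>(n, i). At n (Box (transl \<Gamma>' T' \<Delta>' (Child \<alpha> n i)))) ` {(n, i). Child \<alpha> n i |\<in>| T'}"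
    unfolding kids[symmetric] by (intro image_cong) auto
  then show ?case
    using step.prems(1,2)[of \<alpha>]
    by (subst (1 2) transl.simps) simp
qed

lemma transl_finsert_left [simp]:
  "\<not> anc \<alpha> \<beta> \<Longrightarrow> transl (finsert (\<beta>, A) \<Gamma>) T \<Delta> \<alpha> = transl \<Gamma> T \<Delta> \<alpha>"
  by (rule transl_cong) (auto simp: fms_at_finsert)

lemma transl_finsert_right [simp]:
  "\<not> anc \<alpha> \<beta> \<Longrightarrow> transl \<Gamma> T (finsert (\<beta>, A) \<Delta>) \<alpha> = transl \<Gamma> T \<Delta> \<alpha>"
  by (rule transl_cong) (auto simp: fms_at_finsert)

lemma transl_finsert_tree:
  "\<not> anc \<alpha> \<beta> \<or> \<alpha> = \<beta> \<Longrightarrow> transl \<Gamma> (finsert \<beta> T) \<Delta> \<alpha> = transl \<Gamma> T \<Delta> \<alpha>"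
  by (rule transl_cong) auto

text \<open>The two sequents may differ only in the subtree at \<alpha>. Formulas at \<alpha> may
  change, but membership of \<alpha> in the tree may not, as the parent's translation depends on
  it.\<close>

definition agree_outside ::
  "label \<Rightarrow> lfm fset \<Rightarrow> label fset \<Rightarrow> lfm fset \<Rightarrow> lfm fset \<Rightarrow> label fset \<Rightarrow> lfm fset \<Rightarrow> bool" where
  "agree_outside \<alpha> \<Gamma> T \<Delta> \<Gamma>' T' \<Delta>' \<longleftrightarrow>
    (\<forall>\<beta>. \<not> anc \<alpha> \<beta> \<longrightarrow> fms_at \<Gamma> \<beta> = fms_at \<Gamma>' \<beta> \<and> fms_at \<Delta> \<beta> = fms_at \<Delta>' \<beta>) \<and>
    (\<forall>\<beta>. \<not> anc \<alpha> \<beta> \<or> \<beta> = \<alpha> \<longrightarrow> (\<beta> |\<in>| T \<longleftrightarrow> \<beta> |\<in>| T'))"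

section \<open>Necessity forms as contexts of a label\<close>

primrec root_of :: "label \<Rightarrow> label" where
  "root_of (Root i) = Root i"
| "root_of (Child \<alpha> n i) = root_of \<alpha>"

lemma root_of_in_tree: "tree T \<Longrightarrow> \<alpha> \<in> T \<Longrightarrow> root_of \<alpha> \<in> T"
  by (induction \<alpha>) (auto simp: tree_def)

lemma root_of_eq: "tree T \<Longrightarrow> \<alpha> \<in> T \<Longrightarrow> Root i \<in> T \<Longrightarrow> root_of \<alpha> = Root i"
proof -
  assume "tree T" "\<alpha> \<in> T" "Root i \<in> T"
  moreover obtain j where "root_of \<alpha> = Root j" by (induction \<alpha>) auto
  ultimately show ?thesis using root_of_in_tree[of T \<alpha>] by (auto simp: tree_def)
qed

text \<open>The child contributes exactly one disjunct at \<alpha>. All the rest is the translation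
  at \<alpha> after pruning the child's subtree, and negating it as an antecedent gives the
  disjunction the shape of a necessity form.\<close>

lemma transl_context_step:
  assumes T: "Child \<alpha> n i |\<in>| T"
    and agree: "agree_outside (Child \<alpha> n i) \<Gamma> T \<Delta> \<Gamma>' T' \<Delta>'"
  shows "HEFL (Iff (transl \<Gamma>' T' \<Delta>' \<alpha>)
    (Imp (Neg (transl \<Gamma> (ffilter (\<lambda>\<beta>. \<not> anc (Child \<alpha> n i) \<beta>) T) \<Delta> \<alpha>))
      (At n (Box (transl \<Gamma>' T' \<Delta>' (Child \<alpha> n i))))))"
proof (rule HEFL_conseq0)
  fix v
  let ?c = "Child \<alpha> n i"
  let ?U = "ffilter (\<lambda>\<beta>. \<not> anc ?c \<beta>) T"
  have here: "fms_at \<Gamma> \<alpha> = fms_at \<Gamma>' \<alpha>" "fms_at \<Delta> \<alpha> = fms_at \<Delta>' \<alpha>" "?c |\<in>| T'"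
    using agree T by (auto simp: agree_outside_def)
  have sib: "Child \<alpha> m j |\<in>| ?U \<longleftrightarrow> Child \<alpha> m j |\<in>| T'" if "(m, j) \<noteq> (n, i)" for m j
  proof -
    have "\<not> anc ?c (Child \<alpha> m j)" using that by auto
    then show ?thesis using agree by (simp add: agree_outside_def)
  qed
  \<comment> \<open>Sibling subtrees avoid the pruned part, where alone the two sequents may
    differ.\<close>
  have eq: "transl \<Gamma> ?U \<Delta> (Child \<alpha> m j) = transl \<Gamma>' T' \<Delta>' (Child \<alpha> m j)"
    if "(m, j) \<noteq> (n, i)" for m j
  proof -
    have out: "\<not> anc ?c \<beta>" if "anc (Child \<alpha> m j) \<beta>" for \<beta>
      using anc_siblings[OF that, of n i] \<open>(m, j) \<noteq> (n, i)\<close> by auto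
    show ?thesis
      by (rule transl_cong) (use out agree in \<open>auto simp: agree_outside_def\<close>)
  qed
  have "(\<exists>m j. Child \<alpha> m j |\<in>| T' \<and> v (At m (Box (transl \<Gamma>' T' \<Delta>' (Child \<alpha> m j))))) \<longleftrightarrow>
      v (At n (Box (transl \<Gamma>' T' \<Delta>' ?c))) \<or>
      (\<exists>m j. Child \<alpha> m j |\<in>| ?U \<and> v (At m (Box (transl \<Gamma> ?U \<Delta> (Child \<alpha> m j)))))"
    (is "?L \<longleftrightarrow> ?R")
  proof
    assume ?L
    then obtain m j where mj: "Child \<alpha> m j |\<in>| T'"
        "v (At m (Box (transl \<Gamma>' T' \<Delta>' (Child \<alpha> m j))))"
      by blast
    show ?R
    proof (cases "(m, j) = (n, i)")
      case True
      then show ?thesis using mj by simp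
    next
      case False
      then have "Child \<alpha> m j |\<in>| ?U" "v (At m (Box (transl \<Gamma> ?U \<Delta> (Child \<alpha> m j))))"
        using mj sib eq by simp_all
      then show ?thesis by blast
    qed
  next
    assume ?R
    then show ?L
    proof
      assume "v (At n (Box (transl \<Gamma>' T' \<Delta>' ?c)))"
      then show ?L using here(3) by blast
    next
      assume "\<exists>m j. Child \<alpha> m j |\<in>| ?U \<and> v (At m (Box (transl \<Gamma> ?U \<Delta> (Child \<alpha> m j))))"
      then obtain m j where mj: "Child \<alpha> m j |\<in>| ?U" "v (At m (Box (transl \<Gamma> ?U \<Delta> (Child \<alpha> m j))))"
        by blast
      then have "(m, j) \<noteq> (n, i)" by auto
      then show ?L using sib[of m j] eq[of m j] mj by auto
    qed
  qed
  then show "peval v (Iff (transl \<Gamma>' T' \<Delta>' \<alpha>)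
    (Imp (Neg (transl \<Gamma> ?U \<Delta> \<alpha>)) (At n (Box (transl \<Gamma>' T' \<Delta>' ?c)))))"
    using here(1,2) by (simp add: peval_transl[of v \<Gamma>' T' \<Delta>' \<alpha>] peval_transl[of v \<Gamma> ?U \<Delta> \<alpha>]) blast
qed

text \<open>\<open>L\<close> is chosen before the primed sequents, so one form serves the conclusion
  of a rule and all its premises. The bound on its nominals keeps the eigennominal of the right rule
  for \<open>Fr\<close> out of \<open>L\<close>.\<close>

lemma transl_context:
  assumes "tree (fset T)" "\<alpha> |\<in>| T"
  shows "\<exists>L. noms (plug L Bot) \<subseteq> seq_noms \<Gamma> T \<Delta> \<and>
    (\<forall>\<Gamma>' T' \<Delta>'. agree_outside \<alpha> \<Gamma> T \<Delta> \<Gamma>' T' \<Delta>' \<longrightarrow>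
      HEFL (Iff (transl \<Gamma>' T' \<Delta>' (root_of \<alpha>)) (plug L (transl \<Gamma>' T' \<Delta>' \<alpha>))))"
  using assms
proof (induction \<alpha>)
  case (Root i)
  show ?case by (rule exI[of _ Hash]) (auto intro: HEFL_conseq0)
next
  case (Child \<alpha> n i)
  let ?c = "Child \<alpha> n i"
  let ?U = "ffilter (\<lambda>\<beta>. \<not> anc ?c \<beta>) T"
  have "\<alpha> |\<in>| T" using Child.prems by (auto simp: tree_def)
  then obtain L where L: "noms (plug L Bot) \<subseteq> seq_noms \<Gamma> T \<Delta>"
    "\<And>\<Gamma>' T' \<Delta>'. agree_outside \<alpha> \<Gamma> T \<Delta> \<Gamma>' T' \<Delta>' \<Longrightarrow>
      HEFL (Iff (transl \<Gamma>' T' \<Delta>' (root_of \<alpha>)) (plug L (transl \<Gamma>' T' \<Delta>' \<alpha>)))"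
    using Child.IH Child.prems(1) by blast
  \<comment> \<open>The context of the parent, extended by the single layer from
    \<open>transl_context_step\<close>.\<close>
  define M where "M = nf_comp L (ImpNF (Neg (transl \<Gamma> ?U \<Delta> \<alpha>)) (AtBoxNF n Hash))"
  have "noms (transl \<Gamma> ?U \<Delta> \<alpha>) \<subseteq> seq_noms \<Gamma> T \<Delta>"
    using noms_transl[of \<Gamma> ?U \<Delta> \<alpha>] by (auto simp: seq_noms_def)
  moreover have "n \<in> seq_noms \<Gamma> T \<Delta>"
    using Child.prems(2) by (force simp: seq_noms_def)
  ultimately have "noms (plug M Bot) \<subseteq> seq_noms \<Gamma> T \<Delta>"
    unfolding M_def plug_nf_comp by (subst noms_plug) (use L(1) in simp)
  moreover have "HEFL (Iff (transl \<Gamma>' T' \<Delta>' (root_of ?c)) (plug M (transl \<Gamma>' T' \<Delta>' ?c)))"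
    if agree: "agree_outside ?c \<Gamma> T \<Delta> \<Gamma>' T' \<Delta>'" for \<Gamma>' T' \<Delta>'
  proof -
    let ?A = "transl \<Gamma>' T' \<Delta>' \<alpha>"
    let ?B = "Imp (Neg (transl \<Gamma> ?U \<Delta> \<alpha>)) (At n (Box (transl \<Gamma>' T' \<Delta>' ?c)))"
    \<comment> \<open>The child's subtree lies strictly below \<alpha>, so agreement outside it
      implies agreement outside the subtree at \<alpha>.\<close>
    have "\<not> anc ?c \<beta>" if "\<not> anc \<alpha> \<beta> \<or> \<beta> = \<alpha>" for \<beta>
      using that anc_ChildD by blast
    then have "agree_outside \<alpha> \<Gamma> T \<Delta> \<Gamma>' T' \<Delta>'"
      using agree unfolding agree_outside_def by blast
    then have root: "HEFL (Iff (transl \<Gamma>' T' \<Delta>' (root_of \<alpha>)) (plug L ?A))"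
      by (rule L(2))
    have "HEFL (Iff ?A ?B)"
      by (rule transl_context_step[OF Child.prems(2) agree])
    then have "HEFL (Imp ?A ?B)" "HEFL (Imp ?B ?A)"
      by (rule HEFL_conseq1, auto)+
    from this[THEN plug_mono, of L]
    have "HEFL (Iff (transl \<Gamma>' T' \<Delta>' (root_of \<alpha>)) (plug L ?B))"
      by (rule HEFL_conseq3[OF root]) (unfold peval.simps, blast)
    then show ?thesis by (simp add: M_def)
  qed
  ultimately show ?case by blast
qed

text \<open>Reduces a branching rule to an implication at \<alpha>: the common context
  \<open>L\<close> lifts that implication to the root by \<open>plug_mono2\<close>. The unprimed
  sequent is the conclusion.\<close>

lemma transl_local2:
  assumes "tree (fset T)" "\<alpha> |\<in>| T" "Root i |\<in>| T"
    and 1: "agree_outside \<alpha> \<Gamma> T \<Delta> \<Gamma>1 T1 \<Delta>1" and 2: "agree_outside \<alpha> \<Gamma> T \<Delta> \<Gamma>2 T2 \<Delta>2"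
    and imp: "HEFL (Imp (transl \<Gamma>1 T1 \<Delta>1 \<alpha>) (Imp (transl \<Gamma>2 T2 \<Delta>2 \<alpha>) (transl \<Gamma> T \<Delta> \<alpha>)))"
    and p1: "HEFL (transl \<Gamma>1 T1 \<Delta>1 (Root i))" and p2: "HEFL (transl \<Gamma>2 T2 \<Delta>2 (Root i))"
  shows "HEFL (transl \<Gamma> T \<Delta> (Root i))"
proof -
  have root: "root_of \<alpha> = Root i" using root_of_eq assms(1-3) by blast
  obtain L where L: "\<And>\<Gamma>' T' \<Delta>'. agree_outside \<alpha> \<Gamma> T \<Delta> \<Gamma>' T' \<Delta>' \<Longrightarrow>
      HEFL (Iff (transl \<Gamma>' T' \<Delta>' (Root i)) (plug L (transl \<Gamma>' T' \<Delta>' \<alpha>)))"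
    using transl_context[OF assms(1,2), of \<Gamma> \<Delta>] root by auto
  have "HEFL (plug L (transl \<Gamma>1 T1 \<Delta>1 \<alpha>))" by (rule HEFL_conseq2[OF L[OF 1] p1]) auto
  moreover have "HEFL (plug L (transl \<Gamma>2 T2 \<Delta>2 \<alpha>))" by (rule HEFL_conseq2[OF L[OF 2] p2]) auto
  ultimately have "HEFL (plug L (transl \<Gamma> T \<Delta> \<alpha>))"
    by (rule HEFL_conseq3[OF plug_mono2[OF imp, of L]]) auto
  moreover have "HEFL (Iff (transl \<Gamma> T \<Delta> (Root i)) (plug L (transl \<Gamma> T \<Delta> \<alpha>)))"
    by (rule L) (simp add: agree_outside_def)
  ultimately show ?thesis by (rule HEFL_conseq2) auto
qed

lemma transl_local:
  assumes "tree (fset T)" "\<alpha> |\<in>| T" "Root i |\<in>| T"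
    and "agree_outside \<alpha> \<Gamma> T \<Delta> \<Gamma>' T' \<Delta>'"
    and imp: "HEFL (Imp (transl \<Gamma>' T' \<Delta>' \<alpha>) (transl \<Gamma> T \<Delta> \<alpha>))"
    and "HEFL (transl \<Gamma>' T' \<Delta>' (Root i))"
  shows "HEFL (transl \<Gamma> T \<Delta> (Root i))"
  by (rule transl_local2[OF assms(1-4,4) _ assms(6,6)], rule HEFL_conseq1[OF imp]) auto

section \<open>The rules of the tree sequent calculus\<close>

lemma tree_sequentD:
  assumes "tree_sequent \<Gamma> T \<Delta>"
  shows "tree (fset T)" "(\<alpha>, A) |\<in>| \<Gamma> \<Longrightarrow> \<alpha> |\<in>| T" "(\<alpha>, A) |\<in>| \<Delta> \<Longrightarrow> \<alpha> |\<in>| T"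
  using assms by (auto simp: tree_sequent_def)

text \<open>For initial sequents: a theorem follows from \<open>Top\<close>, which is persistent and
  hence reaches every label.\<close>

lemma transl_valid:
  assumes "tree (fset T)" "\<alpha> |\<in>| T" "Root i |\<in>| T" "HEFL (transl \<Gamma> T \<Delta> \<alpha>)"
  shows "HEFL (transl \<Gamma> T \<Delta> (Root i))"
proof -
  have root: "root_of \<alpha> = Root i" using root_of_eq assms(1-3) by blast
  have "agree_outside \<alpha> \<Gamma> T \<Delta> \<Gamma> T \<Delta>" by (simp add: agree_outside_def)
  then obtain L where L: "HEFL (Iff (transl \<Gamma> T \<Delta> (Root i)) (plug L (transl \<Gamma> T \<Delta> \<alpha>)))"
    using transl_context[OF assms(1,2), of \<Gamma> \<Delta>] root by metis
  have "HEFL (Imp Top (transl \<Gamma> T \<Delta> \<alpha>))" by (rule HEFL_conseq1[OF assms(4)]) auto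
  moreover have "persistent Top"
    unfolding persistent_def
  proof
    fix l
    have "HEFL (At l (Box Top))" by (intro HEFL.Nec_At HEFL.Nec_Box HEFL_conseq0) simp
    then show "HEFL (Imp Top (At l (Box Top)))" by (rule HEFL_conseq1) simp
  qed
  ultimately have "HEFL (Imp Top (plug L (transl \<Gamma> T \<Delta> \<alpha>)))"
    by (intro persistent_plug)
  then show ?thesis by (rule HEFL_conseq2[OF L]) auto
qed

text \<open>As \<alpha> and \<beta> may lie on different branches, the argument splits on the
  equality at the root. If it fails, its negation reaches \<alpha> and refutes the antecedent there;
  if it holds, it discharges the assumption at \<beta>, and weakening adds the one at
  \<alpha>.\<close>

lemma transl_rigid:
  assumes seq: "tree_sequent (finsert (\<alpha>, At n (Nom m)) \<Gamma>) T \<Delta>" and root: "Root i |\<in>| T"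
    and prem: "HEFL (transl (finsert (\<beta>, At n (Nom m)) \<Gamma>) T \<Delta> (Root i))"
  shows "HEFL (transl (finsert (\<alpha>, At n (Nom m)) \<Gamma>) T \<Delta> (Root i))"
proof -
  let ?e = "At n (Nom m)" and ?G = "finsert (\<alpha>, At n (Nom m)) \<Gamma>"
  have \<alpha>: "tree (fset T)" "\<alpha> |\<in>| T" using tree_sequentD[OF seq] by auto
  have "agree_outside \<alpha> ?G T \<Delta> ?G T \<Delta>" by (simp add: agree_outside_def)
  then obtain L where L: "HEFL (Iff (transl ?G T \<Delta> (Root i)) (plug L (transl ?G T \<Delta> \<alpha>)))"
    using transl_context[OF \<alpha>, of ?G \<Delta>] root_of_eq[OF \<alpha> root] by metis
  have "HEFL (Imp (Neg ?e) (transl ?G T \<Delta> \<alpha>))"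
    by (rule HEFL_conseq0) (simp add: peval_transl fms_at_finsert)
  then have "HEFL (Imp (Neg ?e) (plug L (transl ?G T \<Delta> \<alpha>)))"
    by (rule persistent_plug[OF persistent_neq])
  then have neg: "HEFL (Imp (Neg ?e) (transl ?G T \<Delta> (Root i)))"
    by (rule HEFL_conseq2[OF L]) auto
  have "HEFL (Imp ?e (transl \<Gamma> T \<Delta> (Root i)))"
    by (rule HEFL_conseq2[OF transl_discharge[OF persistent_eq, of n m \<beta> \<Gamma> T \<Delta> "Root i"] prem]) auto
  moreover have "HEFL (Imp (transl \<Gamma> T \<Delta> (Root i)) (transl ?G T \<Delta> (Root i)))"
    by (rule transl_weaken) auto
  ultimately show ?thesis by (rule HEFL_conseq3[OF neg]) auto
qed

text \<open>At \<alpha> the premise yields \<open>Imp (At n (DiaF (Nom m))) (At m \<phi>)\<close>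
  under the antecedent \<open>Neg ?R\<close>, where \<open>?R\<close> translates the side formulas.
  Adding this antecedent to \<open>L\<close> gives exactly the necessity form for
  \<open>HEFL.BG\<close>.\<close>

lemma transl_FR:
  assumes seq: "tree_sequent \<Gamma> T (finsert (\<alpha>, At n (Fr \<phi>)) \<Delta>)" and root: "Root i |\<in>| T"
    and fresh: "m \<notin> seq_noms \<Gamma> T (finsert (\<alpha>, At n (Fr \<phi>)) \<Delta>)"
    and prem: "HEFL (transl (finsert (\<alpha>, At n (DiaF (Nom m))) \<Gamma>) T
      (finsert (\<alpha>, At m \<phi>) \<Delta>) (Root i))"
  shows "HEFL (transl \<Gamma> T (finsert (\<alpha>, At n (Fr \<phi>)) \<Delta>) (Root i))"
proof -
  let ?G = "finsert (\<alpha>, At n (DiaF (Nom m))) \<Gamma>" and ?D = "finsert (\<alpha>, At m \<phi>) \<Delta>"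
  let ?E = "finsert (\<alpha>, At n (Fr \<phi>)) \<Delta>"
  let ?R = "transl \<Gamma> T \<Delta> \<alpha>"
  have \<alpha>: "tree (fset T)" "\<alpha> |\<in>| T" using tree_sequentD[OF seq] by auto
  obtain L where noms: "noms (plug L Bot) \<subseteq> seq_noms \<Gamma> T ?E"
    and L: "\<And>\<Gamma>' T' \<Delta>'. agree_outside \<alpha> \<Gamma> T ?E \<Gamma>' T' \<Delta>' \<Longrightarrow>
      HEFL (Iff (transl \<Gamma>' T' \<Delta>' (Root i)) (plug L (transl \<Gamma>' T' \<Delta>' \<alpha>)))"
    using transl_context[OF \<alpha>, of \<Gamma> ?E] root_of_eq[OF \<alpha> root] by auto
  have "agree_outside \<alpha> \<Gamma> T ?E ?G T ?D" by (auto simp: agree_outside_def fms_at_finsert)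
  from L[OF this] have "HEFL (plug L (transl ?G T ?D \<alpha>))"
    by (rule HEFL_conseq2[OF prem]) auto
  moreover have "HEFL (Imp (transl ?G T ?D \<alpha>)
      (plug (ImpNF (Neg ?R) Hash) (Imp (At n (DiaF (Nom m))) (At m \<phi>))))"
    by (rule HEFL_conseq0) (auto simp: peval_transl fms_at_finsert)
  ultimately have "HEFL (plug L (plug (ImpNF (Neg ?R) Hash) (Imp (At n (DiaF (Nom m))) (At m \<phi>))))"
    using plug_mono HEFL.MP by blast
  then have BG: "HEFL (plug (nf_comp L (ImpNF (Neg ?R) Hash)) (Imp (At n (DiaF (Nom m))) (At m \<phi>)))"
    by simp
  have "noms ?R \<subseteq> seq_noms \<Gamma> T ?E"
    using noms_transl[of \<Gamma> T \<Delta> \<alpha>] by (auto simp: seq_noms_def)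
  moreover have "noms (At n (Fr \<phi>)) \<subseteq> seq_noms \<Gamma> T ?E"
    by (auto simp: seq_noms_def)
  ultimately have "m \<notin> noms (plug L (Imp (Neg ?R) (At n (Fr \<phi>))))"
    using noms fresh by (subst noms_plug) auto
  then have "HEFL (plug L (Imp (Neg ?R) (At n (Fr \<phi>))))"
    using HEFL.BG[OF BG] by simp
  moreover have "HEFL (Imp (Imp (Neg ?R) (At n (Fr \<phi>))) (transl \<Gamma> T ?E \<alpha>))"
    by (rule HEFL_conseq0) (auto simp: peval_transl fms_at_finsert)
  ultimately have "HEFL (plug L (transl \<Gamma> T ?E \<alpha>))"
    using plug_mono HEFL.MP by blast
  moreover have "HEFL (Iff (transl \<Gamma> T ?E (Root i)) (plug L (transl \<Gamma> T ?E \<alpha>)))"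
    by (rule L) (simp add: agree_outside_def)
  ultimately show ?thesis by (rule HEFL_conseq2) auto
qed

text \<open>The new child is a leaf carrying only \<open>At n \<phi>\<close>, so its disjunct
  amounts to \<open>At n (Box (At n \<phi>))\<close>, which \<open>HEFL_At_Box_At\<close> turns into
  the principal formula.\<close>

lemma transl_BoxR:
  assumes seq: "tree_sequent \<Gamma> T (finsert (\<alpha>, At n (Box \<phi>)) \<Delta>)" and root: "Root i |\<in>| T"
    and fresh: "Child \<alpha> n j |\<notin>| T"
    and prem: "HEFL (transl \<Gamma> (finsert (Child \<alpha> n j) T) (finsert (Child \<alpha> n j, At n \<phi>) \<Delta>) (Root i))"
  shows "HEFL (transl \<Gamma> T (finsert (\<alpha>, At n (Box \<phi>)) \<Delta>) (Root i))"
proof (rule transl_local[OF _ _ root _ _ prem])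
  let ?c = "Child \<alpha> n j"
  let ?D = "finsert (?c, At n \<phi>) \<Delta>" and ?U = "finsert ?c T"
  show "tree (fset T)" "\<alpha> |\<in>| T" using tree_sequentD[OF seq] by auto
  show "agree_outside \<alpha> \<Gamma> T (finsert (\<alpha>, At n (Box \<phi>)) \<Delta>) \<Gamma> ?U ?D"
    by (auto simp: agree_outside_def fms_at_finsert)
  have empty: "fms_at \<Gamma> ?c = {}" "fms_at \<Delta> ?c = {}"
    using tree_sequentD[OF seq] fresh by (auto simp: fms_at_def)
  \<comment> \<open>Trees are closed under parents, so a label outside \<open>T\<close> has no
    children in \<open>T\<close>.\<close>
  have leaf: "Child ?c m k |\<notin>| ?U" for m k
    using tree_sequentD(1)[OF seq] fresh by (auto simp: tree_def)
  have "HEFL (Imp (transl \<Gamma> ?U ?D ?c) (At n \<phi>))"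
    by (rule HEFL_conseq0) (use empty leaf in \<open>auto simp: peval_transl fms_at_finsert\<close>)
  then have "HEFL (Imp (At n (Box (transl \<Gamma> ?U ?D ?c))) (At n (Box (At n \<phi>))))"
    by (rule HEFL_AtBox_mono)
  then have box: "HEFL (Imp (At n (Box (transl \<Gamma> ?U ?D ?c))) (At n (Box \<phi>)))"
    by (rule HEFL_conseq2[OF HEFL_At_Box_At[of n \<phi>]]) auto
  have eq: "transl \<Gamma> ?U ?D (Child \<alpha> m k) = transl \<Gamma> T \<Delta> (Child \<alpha> m k)"
    if "(m, k) \<noteq> (n, j)" for m k
  proof -
    have "\<not> anc (Child \<alpha> m k) ?c" using that by auto
    then show ?thesis by (simp add: transl_finsert_tree)
  qed
  show "HEFL (Imp (transl \<Gamma> ?U ?D \<alpha>) (transl \<Gamma> T (finsert (\<alpha>, At n (Box \<phi>)) \<Delta>) \<alpha>))"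
  proof (rule HEFL_conseq1[OF box])
    fix v
    assume v: "peval v (Imp (At n (Box (transl \<Gamma> ?U ?D ?c))) (At n (Box \<phi>)))"
    have "v (At n (Box \<phi>)) \<or> (Child \<alpha> m k |\<in>| T \<and> v (At m (Box (transl \<Gamma> T \<Delta> (Child \<alpha> m k)))))"
      if "Child \<alpha> m k |\<in>| ?U" "v (At m (Box (transl \<Gamma> ?U ?D (Child \<alpha> m k))))" for m k
      using that v eq[of m k] by (cases "(m, k) = (n, j)") auto
    then show "peval v (Imp (transl \<Gamma> ?U ?D \<alpha>) (transl \<Gamma> T (finsert (\<alpha>, At n (Box \<phi>)) \<Delta>) \<alpha>))"
      by (simp add: peval_transl[of v _ _ _ \<alpha>] fms_at_finsert del: finsert_iff) blast
  qed
qed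

text \<open>Read in the other direction, \<open>HEFL_At_Box_At\<close> provides
  \<open>At n \<phi>\<close> behind the modality of the child, where it discharges the extra
  assumption.\<close>

lemma transl_BoxL:
  assumes seq: "tree_sequent (finsert (\<alpha>, At n (Box \<phi>)) \<Gamma>) T \<Delta>" and root: "Root i |\<in>| T"
    and prem: "HEFL (transl (finsert (Child \<alpha> n j, At n \<phi>) \<Gamma>) T \<Delta> (Root i))"
  shows "HEFL (transl (finsert (\<alpha>, At n (Box \<phi>)) \<Gamma>) T \<Delta> (Root i))"
proof (rule transl_local[OF _ _ root _ _ prem])
  let ?c = "Child \<alpha> n j"
  let ?G = "finsert (?c, At n \<phi>) \<Gamma>" and ?H = "finsert (\<alpha>, At n (Box \<phi>)) \<Gamma>"
  show "tree (fset T)" "\<alpha> |\<in>| T" using tree_sequentD[OF seq] by auto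
  show "agree_outside \<alpha> ?H T \<Delta> ?G T \<Delta>"
    by (auto simp: agree_outside_def fms_at_finsert)
  have "HEFL (Imp (At n \<phi>) (Imp (transl ?G T \<Delta> ?c) (transl \<Gamma> T \<Delta> ?c)))"
    by (rule HEFL_conseq0) (auto simp: peval_transl[of _ _ _ _ ?c] fms_at_finsert)
  from HEFL_AtBox_mono2[OF this, of n]
  have box: "HEFL (Imp (At n (Box \<phi>)) (Imp (At n (Box (transl ?G T \<Delta> ?c))) (At n (Box (transl \<Gamma> T \<Delta> ?c)))))"
    by (rule HEFL_conseq2[OF HEFL_At_Box_At[of n \<phi>]]) auto
  have eq: "transl ?G T \<Delta> (Child \<alpha> m k) = transl \<Gamma> T \<Delta> (Child \<alpha> m k)"
    if "(m, k) \<noteq> (n, j)" for m k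
  proof -
    have "\<not> anc (Child \<alpha> m k) ?c" using that by auto
    then show ?thesis by simp
  qed
  show "HEFL (Imp (transl ?G T \<Delta> \<alpha>) (transl ?H T \<Delta> \<alpha>))"
  proof (rule HEFL_conseq1[OF box])
    fix v
    assume v: "peval v (Imp (At n (Box \<phi>))
      (Imp (At n (Box (transl ?G T \<Delta> ?c))) (At n (Box (transl \<Gamma> T \<Delta> ?c)))))"
    have "v (At m (Box (transl \<Gamma> T \<Delta> (Child \<alpha> m k))))"
      if "v (At n (Box \<phi>))" "v (At m (Box (transl ?G T \<Delta> (Child \<alpha> m k))))" for m k
      using that v eq[of m k] by (cases "(m, k) = (n, j)") auto
    then show "peval v (Imp (transl ?G T \<Delta> \<alpha>) (transl ?H T \<Delta> \<alpha>))"
      by (simp add: peval_transl[of v _ _ _ \<alpha>] fms_at_finsert) blast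
  qed
qed

text \<open>A new label only adds a disjunct at its parent, so the rule is local there.\<close>

lemma transl_wlab:
  assumes seq: "tree_sequent \<Gamma> (finsert \<alpha> T) \<Delta>" and root: "Root i |\<in>| T"
    and prem: "HEFL (transl \<Gamma> T \<Delta> (Root i))"
  shows "HEFL (transl \<Gamma> (finsert \<alpha> T) \<Delta> (Root i))"
proof (cases "\<alpha> |\<in>| T")
  case True
  then show ?thesis using prem by (simp add: finsert_absorb)
next
  case False
  have tree: "tree (fset (finsert \<alpha> T))" using tree_sequentD(1)[OF seq] .
  obtain \<beta> n j where \<alpha>: "\<alpha> = Child \<beta> n j"
  proof (cases \<alpha>)
    case (Root k)
    \<comment> \<open>A tree has a single root, so a new label cannot be a natural number.\<close>
    then have "k = i" using tree root unfolding tree_def by auto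
    then show ?thesis using Root False root by simp
  qed auto
  then have \<beta>: "\<beta> |\<in>| finsert \<alpha> T" using tree by (auto simp: tree_def)
  have eq: "transl \<Gamma> (finsert \<alpha> T) \<Delta> (Child \<beta> m k) = transl \<Gamma> T \<Delta> (Child \<beta> m k)" for m k
    by (rule transl_finsert_tree) (auto simp: \<alpha>)
  show ?thesis
  proof (rule transl_local[OF tree \<beta> _ _ _ prem])
    show "Root i |\<in>| finsert \<alpha> T" using root by simp
    show "agree_outside \<beta> \<Gamma> (finsert \<alpha> T) \<Delta> \<Gamma> T \<Delta>"
      by (auto simp: agree_outside_def \<alpha>)
    show "HEFL (Imp (transl \<Gamma> T \<Delta> \<beta>) (transl \<Gamma> (finsert \<alpha> T) \<Delta> \<beta>))"
      by (rule HEFL_conseq0) (auto simp: peval_transl[of _ _ _ _ \<beta>] eq)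
  qed
qed

text \<open>Covers all rules that change formulas at one label only.\<close>

lemma agree_outside_same_tree:
  assumes "\<And>\<beta>. \<beta> \<noteq> \<alpha> \<Longrightarrow> fms_at \<Gamma> \<beta> = fms_at \<Gamma>' \<beta> \<and> fms_at \<Delta> \<beta> = fms_at \<Delta>' \<beta>"
  shows "agree_outside \<alpha> \<Gamma> T \<Delta> \<Gamma>' T \<Delta>'"
  unfolding agree_outside_def by (metis assms anc_refl)

lemma TEFL_transl:
  assumes "TEFL \<Gamma> T \<Delta>" "Root i |\<in>| T"
  shows "HEFL (transl \<Gamma> T \<Delta> (Root i))"
  using assms
proof (induction rule: TEFL.induct)
  case (init_bot \<alpha> n \<Gamma> T \<Delta>)
  have "HEFL (transl (finsert (\<alpha>, At n Bot) \<Gamma>) T \<Delta> \<alpha>)"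
    by (rule HEFL_conseq1[OF HEFL_At_Bot[of n]]) (auto simp: peval_transl fms_at_finsert)
  then show ?case
    using tree_sequentD[OF init_bot(1)] init_bot(2) by (intro transl_valid[of _ \<alpha>]) auto
next
  case (init_id \<alpha> n \<phi> \<Gamma> T \<Delta>)
  have "HEFL (transl (finsert (\<alpha>, At n \<phi>) \<Gamma>) T (finsert (\<alpha>, At n \<phi>) \<Delta>) \<alpha>)"
    by (rule HEFL_conseq0) (auto simp: peval_transl fms_at_finsert)
  then show ?case
    using tree_sequentD[OF init_id(1)] init_id(2) by (intro transl_valid[of _ \<alpha>]) auto
next
  case (rep1 \<alpha> n m \<phi> k \<Gamma> T \<Delta>)
  show ?case
  proof (rule transl_local[OF _ _ rep1.prems _ _ rep1.IH[OF rep1.prems]])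
    show "tree (fset T)" "\<alpha> |\<in>| T" using tree_sequentD[OF rep1(2)] by auto
  qed (auto intro!: agree_outside_same_tree HEFL_conseq1[OF HEFL_replacement[of n m \<phi> k]]
      simp: peval_transl fms_at_finsert)
next
  case (rep2 \<alpha> n m \<phi> k \<Gamma> T \<Delta>)
  show ?case
  proof (rule transl_local[OF _ _ rep2.prems _ _ rep2.IH[OF rep2.prems]])
    show "tree (fset T)" "\<alpha> |\<in>| T" using tree_sequentD[OF rep2(2)] by auto
  qed (auto intro!: agree_outside_same_tree HEFL_conseq1[OF HEFL_replacement[of n m \<phi> k]]
      simp: peval_transl fms_at_finsert)
next
  case (ref \<alpha> n \<Gamma> T \<Delta>)
  show ?case
  proof (rule transl_local[OF _ _ ref.prems _ _ ref.IH[OF ref.prems]])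
    show "tree (fset T)" "\<alpha> |\<in>| T" using tree_sequentD[OF TEFL_tree_sequent[OF ref(1)]] by auto
  qed (auto intro!: agree_outside_same_tree HEFL_conseq1[OF HEFL.At_refl[of n]]
      simp: peval_transl fms_at_finsert)
next
  case (rigid \<beta> n m \<Gamma> T \<Delta> \<alpha>)
  show ?case by (rule transl_rigid[OF rigid(2) rigid.prems rigid.IH[OF rigid.prems]])
next
  case (ImpR \<alpha> n \<phi> \<Gamma> T \<psi> \<Delta>)
  show ?case
  proof (rule transl_local[OF _ _ ImpR.prems _ _ ImpR.IH[OF ImpR.prems]])
    show "tree (fset T)" "\<alpha> |\<in>| T" using tree_sequentD[OF ImpR(2)] by auto
  qed (auto intro!: agree_outside_same_tree HEFL_conseq1[OF HEFL_At_Imp[of n \<phi> \<psi>]]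
      simp: peval_transl fms_at_finsert)
next
  case (ImpL \<Gamma> T \<alpha> n \<phi> \<Delta> \<psi>)
  show ?case
  proof (rule transl_local2[OF _ _ ImpL.prems _ _ _ ImpL.IH(1)[OF ImpL.prems] ImpL.IH(2)[OF ImpL.prems]])
    show "tree (fset T)" "\<alpha> |\<in>| T" using tree_sequentD[OF ImpL(3)] by auto
  qed (auto intro!: agree_outside_same_tree HEFL_conseq1[OF HEFL_At_Imp[of n \<phi> \<psi>]]
      simp: peval_transl fms_at_finsert)
next
  case (AtR \<Gamma> T \<alpha> m \<phi> \<Delta> n)
  show ?case
  proof (rule transl_local[OF _ _ AtR.prems _ _ AtR.IH[OF AtR.prems]])
    show "tree (fset T)" "\<alpha> |\<in>| T" using tree_sequentD[OF AtR(2)] by auto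
  qed (auto intro!: agree_outside_same_tree HEFL_conseq1[OF HEFL_At_At[of n m \<phi>]]
      simp: peval_transl fms_at_finsert)
next
  case (AtL \<alpha> m \<phi> \<Gamma> T \<Delta> n)
  show ?case
  proof (rule transl_local[OF _ _ AtL.prems _ _ AtL.IH[OF AtL.prems]])
    show "tree (fset T)" "\<alpha> |\<in>| T" using tree_sequentD[OF AtL(2)] by auto
  qed (auto intro!: agree_outside_same_tree HEFL_conseq1[OF HEFL_At_At[of n m \<phi>]]
      simp: peval_transl fms_at_finsert)
next
  case (FR \<alpha> n m \<Gamma> T \<phi> \<Delta>)
  show ?case by (rule transl_FR[OF FR(3) FR.prems FR(2) FR.IH[OF FR.prems]])
next
  case (FL \<Gamma> T \<alpha> n m \<Delta> \<phi>)
  show ?case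
  proof (rule transl_local2[OF _ _ FL.prems _ _ _ FL.IH(1)[OF FL.prems] FL.IH(2)[OF FL.prems]])
    show "tree (fset T)" "\<alpha> |\<in>| T" using tree_sequentD[OF FL(3)] by auto
  qed (auto intro!: agree_outside_same_tree HEFL_conseq1[OF HEFL_At_F_elim[of n \<phi> m]]
      simp: peval_transl fms_at_finsert)
next
  case (BoxR \<Gamma> \<alpha> n j T \<phi> \<Delta>)
  \<comment> \<open>The number \<open>j\<close> occurs in no label of the conclusion, hence the
    child is new.\<close>
  have "Child \<alpha> n j |\<notin>| T"
    using BoxR(2) by (force simp: seq_nats_def)
  then show ?case
    by (rule transl_BoxR[OF BoxR(3) BoxR.prems]) (use BoxR.IH BoxR.prems in simp)
next
  case (BoxL \<alpha> n j \<phi> \<Gamma> T \<Delta>)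
  show ?case by (rule transl_BoxL[OF BoxL(2) BoxL.prems BoxL.IH[OF BoxL.prems]])
next
  case (wlab \<Gamma> T \<Delta> \<alpha>)
  have tree: "tree (fset T)" "tree (fset (finsert \<alpha> T))"
    using tree_sequentD(1) TEFL_tree_sequent wlab(1,2) by blast+
  \<comment> \<open>The premise has its own root, which must be \<open>Root i\<close> because the
    larger tree has only one.\<close>
  obtain j where "Root j |\<in>| T" using tree(1) by (auto simp: tree_def)
  then have "Root i |\<in>| T" using tree(2) wlab.prems by (auto simp: tree_def)
  then show ?case using transl_wlab[OF wlab(2)] wlab.IH by simp
next
  case (Cut \<Gamma> T \<alpha> n \<phi> \<Delta> \<Pi> \<Sigma>)
  let ?G = "\<Gamma> |\<union>| \<Pi>" and ?D = "\<Delta> |\<union>| \<Sigma>"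
  \<comment> \<open>Both premises are first weakened to the joint context; only then do they differ
    from the conclusion at \<alpha> alone.\<close>
  have "HEFL (Imp (transl \<Gamma> T (finsert (\<alpha>, At n \<phi>) \<Delta>) (Root i))
      (transl ?G T (finsert (\<alpha>, At n \<phi>) ?D) (Root i)))"
    by (rule transl_weaken) auto
  then have p1: "HEFL (transl ?G T (finsert (\<alpha>, At n \<phi>) ?D) (Root i))"
    using Cut.IH(1)[OF Cut.prems] by (rule HEFL.MP)
  have "HEFL (Imp (transl (finsert (\<alpha>, At n \<phi>) \<Pi>) T \<Sigma> (Root i))
      (transl (finsert (\<alpha>, At n \<phi>) ?G) T ?D (Root i)))"
    by (rule transl_weaken) auto
  then have p2: "HEFL (transl (finsert (\<alpha>, At n \<phi>) ?G) T ?D (Root i))"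
    using Cut.IH(2)[OF Cut.prems] by (rule HEFL.MP)
  show ?case
  proof (rule transl_local2[OF _ _ Cut.prems _ _ _ p1 p2])
    show "tree (fset T)" "\<alpha> |\<in>| T" using tree_sequentD[OF TEFL_tree_sequent[OF Cut(1)]] by auto
  qed (auto intro!: agree_outside_same_tree HEFL_conseq0 simp: peval_transl fms_at_finsert)
qed

theorem theorem3:
  fixes \<Gamma> \<Delta> :: "lfm fset" and T :: "label fset" and i :: nat
  assumes "tree_sequent \<Gamma> T \<Delta>"
    and "TEFL \<Gamma> T \<Delta>"
    and "Root i |\<in>| T"
  shows "HEFL (transl \<Gamma> T \<Delta> (Root i))"
  using assms(2,3) by (rule TEFL_transl)

end
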